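(* Let $d\ge 1$ and $k\ge 1$ be integers. Given a set of $k+d+2$ points in $\mathbb{R}^d$, each coloured with one of $k$ possible colours, there exist two disjoint subsets $A$ and $B$ of it such that $A$ and $B$ contain the same number of points of each colour and $\mathrm{conv}(A)\cap\mathrm{conv}(B)\neq\emptyset$. *)

theory Defs
  imports "HOL-Analysis.Analysis"
begin

end

theory Submission
  imports Defs
begin

text \<open>
  The statement is a discrete ham sandwich theorem for the affine dependencies of \<open>P\<close>: we look for a
  dependency whose positive part and whose negative part each meet every colour class in at most half
  of its points. The points with coefficient zero can then be distributed so as to equalise the colours.

  With \<open>n = k + d + 2\<close>, consider the barycentric subdivision of the boundary of the \<open>n\<close>-dimensional
  cross polytope, whose vertices are the nonempty consistent sets of signed indices. Map it to
  \<open>\<real>\<^sup>d \<times> \<real> \<times> \<real>\<^sup>k\<close> by the signed sum of the points, the signed count, and for each colour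
  \<open>1\<close> or \<open>-1\<close> if more than half of the colour class occurs with a positive or a negative sign. Along a
  chain of signed sets the latter sign cannot change, so a zero of this odd map is such a dependency.

  The existence of a zero is a piecewise linear Borsuk-Ulam theorem. For a generic odd map, the number of
  zeros in the upper hemisphere is odd in each dimension: count pairs of a simplex and a facet
  whose image meets a positive coordinate ray. A simplex has an odd number of such facets iff it contains a
  zero, and a facet lies in two simplices unless it lies on the equator, where the count
  is that of the previous dimension. The general case follows by perturbation and compactness.
\<close>

section \<open>Kernels of generic systems\<close>

text \<open>Gaussian elimination, by induction on the equations: if some unknown \<open>r0\<close>
  occurs in equation \<open>e\<close>, solve \<open>e\<close> for it and substitute into the others,
  leaving one equation and one unknown fewer.\<close>

lemma homogeneous_system_nontrivial:
  fixes M :: "'a \<Rightarrow> 'b \<Rightarrow> real"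
  assumes "finite E" "finite S" "card E < card S"
  shows "\<exists>u. (\<exists>r\<in>S. u r \<noteq> 0) \<and> (\<forall>a\<in>E. (\<Sum>r\<in>S. u r * M r a) = 0)"
  using assms
proof (induction E arbitrary: S M rule: finite_induct)
  case empty
  then have "S \<noteq> {}" by auto
  then show ?case by (intro exI[of _ "\<lambda>_. 1"]) auto
next
  case (insert e E)
  show ?case
  proof (cases "\<forall>r\<in>S. M r e = 0")
    case True
    have "card E < card S" using insert by simp
    then obtain u where "\<exists>r\<in>S. u r \<noteq> 0" "\<forall>a\<in>E. (\<Sum>r\<in>S. u r * M r a) = 0"
      using insert.IH[of S M] insert.prems by blast
    with True show ?thesis by (intro exI[of _ u]) auto
  next
    case False
    then obtain r0 where r0: "r0 \<in> S" "M r0 e \<noteq> 0" by auto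
    let ?S = "S - {r0}"
    let ?M = "\<lambda>r a. M r a - M r e / M r0 e * M r0 a"
    have "card E < card ?S" using insert r0 by simp
    then obtain u where u: "\<exists>r\<in>?S. u r \<noteq> 0" "\<forall>a\<in>E. (\<Sum>r\<in>?S. u r * ?M r a) = 0"
      using insert.IH[of ?S ?M] insert.prems by blast
    define c where "c = - (\<Sum>r\<in>?S. u r * M r e) / M r0 e"
    have eq: "(\<Sum>r\<in>S. (u(r0 := c)) r * M r a) = (\<Sum>r\<in>?S. u r * ?M r a)" for a
    proof -
      have "(\<Sum>r\<in>S. (u(r0 := c)) r * M r a) = c * M r0 a + (\<Sum>r\<in>?S. (u(r0 := c)) r * M r a)"
        using r0 insert.prems by (subst sum.remove[of _ r0]) auto
      also have "(\<Sum>r\<in>?S. (u(r0 := c)) r * M r a) = (\<Sum>r\<in>?S. u r * M r a)"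
        by (rule sum.cong) auto
      also have "c * M r0 a = - (\<Sum>r\<in>?S. u r * (M r e / M r0 e * M r0 a))"
        by (simp add: c_def sum_distrib_right sum_divide_distrib mult.assoc)
      finally show ?thesis by (simp add: sum_subtractf algebra_simps)
    qed
    have "(\<Sum>r\<in>S. (u(r0 := c)) r * M r e) = 0"
      unfolding eq using r0 by simp
    moreover have "\<forall>a\<in>E. (\<Sum>r\<in>S. (u(r0 := c)) r * M r a) = 0"
      unfolding eq using u by blast
    moreover have "\<exists>r\<in>S. (u(r0 := c)) r \<noteq> 0" using u by auto
    ultimately show ?thesis by (intro exI[of _ "u(r0 := c)"]) blast
  qed
qed

lemma even_card_involution:
  assumes "finite A" "\<And>x. x \<in> A \<Longrightarrow> f x \<in> A" "\<And>x. x \<in> A \<Longrightarrow> f (f x) = x"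
    "\<And>x. x \<in> A \<Longrightarrow> f x \<noteq> x"
  shows "even (card A)"
  using assms
proof (induction A rule: finite_psubset_induct)
  case (psubset A)
  show ?case
  proof (cases "A = {}")
    case False
    then obtain x where x: "x \<in> A" by auto
    let ?B = "A - {x, f x}"
    have "f y \<in> ?B" if "y \<in> ?B" for y
    proof -
      have "y \<in> A" "y \<noteq> x" "y \<noteq> f x" using that by auto
      then show ?thesis
        using psubset.prems(1)[of y] psubset.prems(2)[of y] psubset.prems(2)[OF x] by auto
    qed
    then have "even (card ?B)"
      using psubset.prems(2,3) x by (intro psubset.IH) auto
    moreover have "card A = card ?B + 2"
    proof -
      have "card {x, f x} = 2" using x psubset.prems(3)[of x] by (metis card_2_iff)
      moreover have "card {x, f x} \<le> card A"
        using psubset.hyps psubset.prems(1) x by (intro card_mono) auto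
      moreover have "card ?B = card A - card {x, f x}"
        using psubset.prems(1) x by (intro card_Diff_subset) auto
      ultimately show ?thesis by simp
    qed
    ultimately show ?thesis by simp
  qed simp
qed

text \<open>Any \<open>s\<close> rows, truncated to their first \<open>s\<close> columns, are linearly independent.\<close>
definition generic_rows :: "(nat \<Rightarrow> nat \<Rightarrow> real) \<Rightarrow> nat \<Rightarrow> bool" where
  "generic_rows M m \<longleftrightarrow> (\<forall>S\<subseteq>{..<m}. \<forall>t. (\<forall>a<card S. (\<Sum>r\<in>S. t r * M r a) = 0) \<longrightarrow> (\<forall>r\<in>S. t r = 0))"

text \<open>Up to scaling, \<open>t\<close> is a convex combination showing that the origin lies in
  the convex hull of the \<open>m\<close> rows projected to their first \<open>p\<close>
  coordinates. For the images of the vertices of a simplex, it is a zero of the linear map on that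
  simplex.\<close>

definition nonneg_kernel :: "(nat \<Rightarrow> nat \<Rightarrow> real) \<Rightarrow> nat \<Rightarrow> nat \<Rightarrow> (nat \<Rightarrow> real) \<Rightarrow> bool" where
  "nonneg_kernel M m p t \<longleftrightarrow> (\<forall>r<m. t r \<ge> 0) \<and> (\<exists>r<m. t r > 0) \<and>
     (\<forall>a<p. (\<Sum>r<m. t r * M r a) = 0)"

text \<open>At most \<open>p\<close> rows lie outside \<open>Z\<close>, so the \<open>p\<close>
  vanishing columns include the square system to which genericity applies.\<close>

lemma generic_kernel_zero:
  assumes "generic_rows M m" "Z \<subseteq> {..<m}" "m \<le> p + card Z" "\<forall>z\<in>Z. t z = 0"
    "\<forall>a<p. (\<Sum>r<m. t r * M r a) = 0" "r < m"
  shows "t r = 0"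
proof (cases "r \<in> Z")
  case False
  let ?S = "{..<m} - Z"
  have "card ?S \<le> p"
    using assms by (simp add: card_Diff_subset finite_subset)
  moreover have "(\<Sum>r\<in>?S. t r * M r a) = (\<Sum>r<m. t r * M r a)" for a
    using assms by (intro sum.mono_neutral_left) auto
  ultimately have "\<forall>a<card ?S. (\<Sum>r\<in>?S. t r * M r a) = 0"
    using assms by auto
  then show ?thesis
    using assms False unfolding generic_rows_def by (metis DiffI Diff_subset lessThan_iff)
qed (use assms in auto)

text \<open>An element of the kernel of the first \<open>p\<close> columns is thus determined by any
  two of its coordinates.\<close>

lemma generic_kernel_zero2:
  assumes "generic_rows M (p + 2)" "\<forall>a<p. (\<Sum>r<p+2. t r * M r a) = 0"
    "x < p + 2" "y < p + 2" "x \<noteq> y" "t x = 0" "t y = 0" "r < p + 2"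
  shows "t r = 0"
  using generic_kernel_zero[of M "p+2" "{x, y}" p t r] assms by auto

section \<open>The cone of nonnegative solutions and the parity of positive facets\<close>

text \<open>The ratio test of the simplex method: \<open>c\<close> is the least multiple of
  \<open>s\<close> that makes \<open>u\<close> nonnegative on \<open>A\<close>, and \<open>x\<close>
  is where it is tight.\<close>

lemma ratio_step:
  fixes u s :: "nat \<Rightarrow> real"
  assumes "finite A" "A \<noteq> {}" "\<forall>r\<in>A. s r > 0"
  obtains c x where "x \<in> A" "u x + c * s x = 0" "\<forall>r\<in>A. u r + c * s r \<ge> 0"
proof -
  let ?q = "\<lambda>r. - u r / s r"
  have "Max (?q ` A) \<in> ?q ` A" using assms by (intro Max_in) auto
  then obtain x where x: "x \<in> A" "Max (?q ` A) = ?q x" by auto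
  have "u r + ?q x * s r \<ge> 0" if "r \<in> A" for r
  proof -
    have "?q r \<le> ?q x" unfolding x(2)[symmetric] using that assms by (intro Max_ge) auto
    then have "?q r * s r \<le> ?q x * s r" using assms that by (intro mult_right_mono) (auto simp: less_imp_le)
    moreover have "?q r * s r = - u r" using assms that by (metis less_numeral_extra(3) nonzero_eq_divide_eq)
    ultimately show ?thesis by linarith
  qed
  moreover have "u x + ?q x * s x = 0" using x assms by auto
  ultimately show ?thesis using that x by blast
qed

text \<open>A second vanishing coordinate would force all of \<open>s\<close> to vanish.\<close>

lemma facet_solution_pos:
  assumes gen: "generic_rows M (p + 2)" and s: "nonneg_kernel M (p + 2) p s"
    and v: "v < p + 2" "s v = 0" and r: "r < p + 2" "r \<noteq> v"
  shows "s r > 0"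
proof (rule ccontr)
  assume "\<not> 0 < s r"
  with s r have "s r = 0" unfolding nonneg_kernel_def by force
  then have "\<forall>r'<p+2. s r' = 0"
    using generic_kernel_zero2[OF gen, of s r v] s r v unfolding nonneg_kernel_def by blast
  with s show False unfolding nonneg_kernel_def by force
qed

text \<open>From a strictly positive solution, move along another kernel direction until some
  coordinate reaches zero.\<close>

lemma facet_solution_exists:
  assumes t: "nonneg_kernel M (p + 2) p t"
  obtains s v where "v < p + 2" "nonneg_kernel M (p + 2) p s" "s v = 0"
proof (cases "\<forall>r<p+2. t r > 0")
  case False
  then obtain v where "v < p + 2" "\<not> t v > 0" by blast
  moreover from this t have "t v = 0" unfolding nonneg_kernel_def by force
  ultimately show ?thesis using that t by blast
next
  case True
  \<comment> \<open>The index \<open>None\<close> stands for the additional equation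
    \<open>u 0 = 0\<close>. As \<open>t 0 > 0\<close>, it prevents \<open>u\<close> from being a
    nonzero multiple of \<open>t\<close>.\<close>
  let ?E = "insert None (Some ` {..<p})"
  have "card ?E < card {..<p+2}"
    by (subst card_insert_disjoint) (auto simp: card_image)
  from homogeneous_system_nontrivial[OF _ _ this,
      of "\<lambda>r e. case e of None \<Rightarrow> of_bool (r = 0) | Some a \<Rightarrow> M r a"]
  obtain u where u: "\<exists>r\<in>{..<p+2}. u r \<noteq> 0" "\<forall>a<p. (\<Sum>r<p+2. u r * M r a) = 0"
    "(\<Sum>r<p+2. u r * of_bool (r = 0)) = 0"
    by auto
  have u0: "u 0 = 0" using u(3) by (simp add: of_bool_def if_distrib sum.delta cong: if_cong)
  obtain c x where cx: "x \<in> {..<p+2}" "u x + c * t x = 0" "\<forall>r\<in>{..<p+2}. u r + c * t r \<ge> 0"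
    by (rule ratio_step[of "{..<p+2}" t u]) (use True in auto)
  let ?h = "\<lambda>r. u r + c * t r"
  have "(\<Sum>r<p+2. ?h r * M r a) = (\<Sum>r<p+2. u r * M r a) + c * (\<Sum>r<p+2. t r * M r a)" for a
    by (simp add: algebra_simps sum.distrib sum_distrib_left)
  then have "\<forall>a<p. (\<Sum>r<p+2. ?h r * M r a) = 0"
    using u t unfolding nonneg_kernel_def by simp
  moreover have "\<exists>r<p+2. ?h r > 0"
  proof (rule ccontr)
    assume "\<not> ?thesis"
    with cx have h0: "?h r = 0" if "r < p + 2" for r using that by (meson lessThan_iff linorder_not_less order_antisym)
    from h0[of 0] u0 True have "c = 0" by auto
    with h0 u(1) show False by auto
  qed
  ultimately have "nonneg_kernel M (p + 2) p ?h"
    unfolding nonneg_kernel_def using cx by blast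
  then show ?thesis using that[of x ?h] cx by auto
qed

text \<open>The kernel of the first \<open>p\<close> columns is two-dimensional, so its nonnegative part is a planar cone; its two
  extreme rays are the facets containing a solution.\<close>
lemma facet_pivot:
  assumes gen: "generic_rows M (p + 2)" and s: "nonneg_kernel M (p + 2) p s"
    and v: "v < p + 2" "s v = 0"
  obtains s' x where "x < p + 2" "x \<noteq> v" "nonneg_kernel M (p + 2) p s'" "s' x = 0"
    "\<And>t. nonneg_kernel M (p + 2) p t \<Longrightarrow>
       \<exists>c d. c \<ge> 0 \<and> d \<ge> 0 \<and> (\<forall>r<p+2. t r = c * s r + d * s' r)"
proof -
  note spos = facet_solution_pos[OF gen s v]
  \<comment> \<open>Any index other than \<open>v\<close> serves. The additional equation
    \<open>u w = 0\<close> then forces \<open>u v \<noteq> 0\<close>, since a kernel element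
    vanishing at both indices is zero.\<close>
  define w where "w = (if v = 0 then 1 else 0 :: nat)"
  have w: "w < p + 2" "w \<noteq> v" unfolding w_def by auto
  let ?E = "insert None (Some ` {..<p})"
  have "card ?E < card {..<p+2}"
    by (subst card_insert_disjoint) (auto simp: card_image)
  from homogeneous_system_nontrivial[OF _ _ this,
      of "\<lambda>r e. case e of None \<Rightarrow> of_bool (r = w) | Some a \<Rightarrow> M r a"]
  obtain u where u: "\<exists>r\<in>{..<p+2}. u r \<noteq> 0" "\<forall>a<p. (\<Sum>r<p+2. u r * M r a) = 0"
    "(\<Sum>r<p+2. u r * of_bool (r = w)) = 0"
    by auto
  have uw: "u w = 0" using u(3) w by (simp add: of_bool_def if_distrib sum.delta cong: if_cong)
  have uv: "u v \<noteq> 0"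
    using generic_kernel_zero2[OF gen u(2) v(1) w(1)] w uw u(1) by auto
  define u1 where "u1 r = u r / u v" for r
  have u1: "\<forall>a<p. (\<Sum>r<p+2. u1 r * M r a) = 0" "u1 v = 1"
  proof -
    have "(\<Sum>r<p+2. u1 r * M r a) = (\<Sum>r<p+2. u r * M r a) / u v" for a
      unfolding u1_def sum_divide_distrib by (rule sum.cong) auto
    then show "\<forall>a<p. (\<Sum>r<p+2. u1 r * M r a) = 0" using u by simp
  qed (use uv in \<open>auto simp: u1_def\<close>)
  \<comment> \<open>Since \<open>s v = 0\<close>, adding multiples of \<open>s\<close> keeps the
    coordinate at \<open>v\<close> equal to 1, so the ratio test is run on the other indices
    only.\<close>
  have "{..<p+2} - {v} \<noteq> {}" using w by auto
  then obtain c x where cx: "x \<in> {..<p+2} - {v}" "u1 x + c * s x = 0"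
    "\<forall>r\<in>{..<p+2} - {v}. u1 r + c * s r \<ge> 0"
    using ratio_step[of "{..<p+2} - {v}" s u1] spos by (metis DiffE finite_Diff finite_lessThan lessThan_iff singletonI)
  define s' where "s' r = u1 r + c * s r" for r
  have lin: "(\<Sum>r<p+2. (f r + e * g r) * M r a) = (\<Sum>r<p+2. f r * M r a) + e * (\<Sum>r<p+2. g r * M r a)"
    for f g e a
    by (simp add: algebra_simps sum.distrib sum_distrib_left)
  have s'ker: "\<forall>a<p. (\<Sum>r<p+2. s' r * M r a) = 0"
    unfolding s'_def lin using u1 s unfolding nonneg_kernel_def by simp
  have s'v: "s' v = 1" using u1 v by (simp add: s'_def)
  have s'0: "s' r \<ge> 0" if "r < p + 2" for r
    using cx that s'v unfolding s'_def by (cases "r = v") auto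
  have nn: "nonneg_kernel M (p + 2) p s'"
    unfolding nonneg_kernel_def using s'ker s'0 s'v v by (auto intro!: exI[of _ v])
  have s'x: "s' x = 0" using cx by (simp add: s'_def)
  have "\<exists>c d. c \<ge> 0 \<and> d \<ge> 0 \<and> (\<forall>r<p+2. t r = c * s r + d * s' r)"
    if t: "nonneg_kernel M (p + 2) p t" for t
  proof -
    \<comment> \<open>The coefficients are read off at \<open>x\<close>, where \<open>s'\<close>
      vanishes, and at \<open>v\<close>, where \<open>s\<close> vanishes and \<open>s'\<close> is 1.
      The remainder vanishes at both and hence everywhere.\<close>
    define e where "e = t x / s x"
    have sx: "s x > 0" using cx spos by auto
    let ?h = "\<lambda>r. (t r + (- e) * s r) + (- t v) * s' r"
    have "\<forall>a<p. (\<Sum>r<p+2. ?h r * M r a) = 0"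
      unfolding lin using s'ker t s unfolding nonneg_kernel_def by simp
    moreover have "?h v = 0" using v s'v by simp
    moreover have "?h x = 0" using s'x sx by (simp add: e_def)
    ultimately have h: "?h r = 0" if "r < p + 2" for r
      using generic_kernel_zero2[OF gen, of ?h x v r] that cx v by auto
    have "t r = e * s r + t v * s' r" if "r < p + 2" for r
      using h[OF that] by linarith
    moreover have "e \<ge> 0" "t v \<ge> 0"
      using sx t cx v unfolding nonneg_kernel_def e_def by auto
    ultimately show ?thesis by blast
  qed
  then show ?thesis using that cx nn s'x by auto
qed

text \<open>Index \<open>v\<close> stands for the facet opposite vertex \<open>v\<close>. If the
  solution cone is not empty, it has two extreme rays, each on one facet. The count is odd iff the
  coordinate \<open>p\<close> has opposite signs on them, that is, iff it vanishes somewhere between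
  them.\<close>

lemma facet_parity:
  assumes gen: "generic_rows M (p + 2)"
  shows "odd (card {v. v < p + 2 \<and> (\<exists>t. nonneg_kernel M (p + 2) p t \<and> t v = 0 \<and> (\<Sum>r<p+2. t r * M r p) > 0)})
     \<longleftrightarrow> (\<exists>t. nonneg_kernel M (p + 2) (p + 1) t)" (is "odd (card ?G) \<longleftrightarrow> ?Z")
proof (cases "\<exists>s v. v < p + 2 \<and> nonneg_kernel M (p + 2) p s \<and> s v = 0")
  case False
  have "nonneg_kernel M (p + 2) p t" if "nonneg_kernel M (p + 2) (p + 1) t" for t
    using that unfolding nonneg_kernel_def by auto
  with False have "\<not> ?Z" using facet_solution_exists by metis
  moreover have "?G = {}" using False by auto
  ultimately show ?thesis by (simp only: card.empty) simp
next
  case True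
  then obtain s v where s: "v < p + 2" "nonneg_kernel M (p + 2) p s" "s v = 0" by blast
  obtain s' x where s': "x < p + 2" "x \<noteq> v" "nonneg_kernel M (p + 2) p s'" "s' x = 0"
    and cone: "\<And>t. nonneg_kernel M (p + 2) p t \<Longrightarrow>
       \<exists>c d. c \<ge> 0 \<and> d \<ge> 0 \<and> (\<forall>r<p+2. t r = c * s r + d * s' r)"
    by (rule facet_pivot[OF gen s(2,1,3)]) (rule that)
  \<comment> \<open>The next coordinate as a linear functional; by genericity it cannot vanish on a
    solution lying on a facet.\<close>
  define \<phi> where "\<phi> t = (\<Sum>r<p+2. t r * M r p)" for t
  have \<phi>0: "\<phi> t \<noteq> 0" if "nonneg_kernel M (p + 2) p t" "y < p + 2" "t y = 0" for t y
  proof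
    assume "\<phi> t = 0"
    then have "\<forall>a<p+1. (\<Sum>r<p+2. t r * M r a) = 0"
      using that unfolding nonneg_kernel_def \<phi>_def by (auto simp: less_Suc_eq)
    then have "t r = 0" if "r < p + 2" for r
      by (intro generic_kernel_zero[OF gen, of "{y}" "p + 1" t r])
        (use that \<open>t y = 0\<close> \<open>y < p + 2\<close> in auto)
    with that(1) show False unfolding nonneg_kernel_def by force
  qed
  have \<phi>lin: "\<phi> t = c * \<phi> s + d * \<phi> s'" if "\<forall>r<p+2. t r = c * s r + d * s' r" for t c d
  proof -
    have "\<phi> t = (\<Sum>r<p+2. (c * s r + d * s' r) * M r p)"
      unfolding \<phi>_def using that by (intro sum.cong) auto
    then show ?thesis unfolding \<phi>_def by (simp add: algebra_simps sum.distrib sum_distrib_left)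
  qed
  note sp = facet_solution_pos[OF gen s(2,1,3)] and sp' = facet_solution_pos[OF gen s'(3,1,4)]
  \<comment> \<open>A solution \<open>c * s + d * s'\<close> vanishing at \<open>y\<close> has both
    terms zero there. As \<open>s\<close> is positive off \<open>v\<close> and \<open>s'\<close> off
    \<open>x\<close>, it is a multiple of a single extreme ray.\<close>
  have G: "?G = {y. y = v \<and> \<phi> s > 0} \<union> {y. y = x \<and> \<phi> s' > 0}" (is "_ = ?R")
  proof (intro equalityI subsetI)
    fix y assume "y \<in> ?G"
    then obtain t where y: "y < p + 2" and t: "nonneg_kernel M (p + 2) p t" "t y = 0" "\<phi> t > 0"
      unfolding \<phi>_def by blast
    obtain c d where cd: "c \<ge> 0" "d \<ge> 0" "\<forall>r<p+2. t r = c * s r + d * s' r"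
      using cone[OF t(1)] by blast
    have "c * s y + d * s' y = 0" using cd y t by metis
    moreover have "c * s y \<ge> 0" "d * s' y \<ge> 0"
      using cd s s' y unfolding nonneg_kernel_def by auto
    ultimately have z: "c * s y = 0" "d * s' y = 0" by linarith+
    have pt: "c * \<phi> s + d * \<phi> s' > 0" using \<phi>lin[OF cd(3)] t(3) by simp
    consider "y = v" | "y = x" | "y \<noteq> v" "y \<noteq> x" by blast
    then show "y \<in> ?R"
    proof cases
      case 1
      then have "d = 0" using z(2) sp'[of v] s s' by auto
      then have "\<phi> s > 0" using pt cd(1) by (simp add: zero_less_mult_iff)
      with 1 show ?thesis by simp
    next
      case 2
      then have "c = 0" using z(1) sp[of x] s s' by auto
      then have "\<phi> s' > 0" using pt cd(2) by (simp add: zero_less_mult_iff)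
      with 2 show ?thesis by simp
    next
      case 3
      then have "c = 0" "d = 0" using z sp[of y] sp'[of y] y by auto
      with pt show ?thesis by simp
    qed
  next
    fix y assume "y \<in> ?R"
    then show "y \<in> ?G" using s s' unfolding \<phi>_def by blast
  qed
  have ne: "\<phi> s \<noteq> 0" "\<phi> s' \<noteq> 0" using \<phi>0 s s' by blast+
  have "odd (card ?G) \<longleftrightarrow> \<phi> s * \<phi> s' < 0"
    using ne s'(2) unfolding G
    by (cases "\<phi> s > 0"; cases "\<phi> s' > 0") (auto simp: mult_less_0_iff card_insert_if not_less)
  also have "\<dots> \<longleftrightarrow> ?Z"
  proof
    assume opp: "\<phi> s * \<phi> s' < 0"
    \<comment> \<open>The weights make the opposite values of \<open>\<phi>\<close> on the two rays
      cancel.\<close>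
    define t where "t r = \<bar>\<phi> s'\<bar> * s r + \<bar>\<phi> s\<bar> * s' r" for r
    have "(\<Sum>r<p+2. t r * M r a) = \<bar>\<phi> s'\<bar> * (\<Sum>r<p+2. s r * M r a) + \<bar>\<phi> s\<bar> * (\<Sum>r<p+2. s' r * M r a)" for a
      unfolding t_def by (simp add: algebra_simps sum.distrib sum_distrib_left)
    then have "\<forall>a<p. (\<Sum>r<p+2. t r * M r a) = 0"
      using s(2) s'(3) unfolding nonneg_kernel_def by simp
    moreover have "(\<Sum>r<p+2. t r * M r p) = 0"
    proof -
      have "\<phi> t = \<bar>\<phi> s'\<bar> * \<phi> s + \<bar>\<phi> s\<bar> * \<phi> s'" by (rule \<phi>lin) (simp add: t_def)
      also have "\<dots> = 0" using opp by (auto simp: mult_less_0_iff abs_if)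
      finally show ?thesis by (simp add: \<phi>_def)
    qed
    ultimately have "\<forall>a<p+1. (\<Sum>r<p+2. t r * M r a) = 0"
      by (auto simp: less_Suc_eq)
    moreover have "t r \<ge> 0" if "r < p + 2" for r
      using s(2) s'(3) that unfolding t_def nonneg_kernel_def by auto
    moreover have "t v > 0"
      using sp'[of v] s s' ne unfolding t_def by auto
    ultimately show ?Z using s(1) unfolding nonneg_kernel_def by blast
  next
    assume ?Z
    then obtain t where t: "nonneg_kernel M (p + 2) (p + 1) t" by blast
    then have "nonneg_kernel M (p + 2) p t" unfolding nonneg_kernel_def by auto
    then obtain c d where cd: "c \<ge> 0" "d \<ge> 0" "\<forall>r<p+2. t r = c * s r + d * s' r"
      using cone by blast
    have "\<phi> t = 0" using t unfolding \<phi>_def nonneg_kernel_def by simp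
    then have eq: "c * \<phi> s + d * \<phi> s' = 0" using \<phi>lin[OF cd(3)] by simp
    have "c \<noteq> 0 \<or> d \<noteq> 0" using t cd(3) unfolding nonneg_kernel_def by force
    with eq ne have "c \<noteq> 0" "d \<noteq> 0" by auto
    with cd(1,2) have "c > 0" "d > 0" by auto
    with eq ne show "\<phi> s * \<phi> s' < 0"
      by (smt (verit) mult_neg_neg mult_pos_pos mult_less_0_iff)
  qed
  finally show ?thesis .
qed

section \<open>Signed permutations as maximal chains of signed sets\<close>

text \<open>The list \<open>xs\<close> encodes the maximal chain formed by the sets of entries of its nonempty prefixes.\<close>
definition signed_perms :: "nat \<Rightarrow> (nat \<times> bool) list set" where
  "signed_perms m = {xs. distinct (map fst xs) \<and> set (map fst xs) = {..<m}}"

text \<open>Row \<open>r\<close> is the image of the vertex given by the chain member of size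
  \<open>r + 1\<close>; rows are indexed from 0 and the empty prefix is skipped.\<close>

definition chain_rows :: "((nat \<times> bool) set \<Rightarrow> nat \<Rightarrow> real) \<Rightarrow> (nat \<times> bool) list \<Rightarrow> nat \<Rightarrow> nat \<Rightarrow> real" where
  "chain_rows F xs r = F (set (take (Suc r) xs))"

text \<open>The facets, named by their opposite vertices, whose image meets the positive ray of
  coordinate \<open>p\<close>.\<close>

definition pos_facets :: "(nat \<Rightarrow> nat \<Rightarrow> real) \<Rightarrow> nat \<Rightarrow> nat set" where
  "pos_facets M p = {v. v < p + 2 \<and>
     (\<exists>t. nonneg_kernel M (p + 2) p t \<and> t v = 0 \<and> (\<Sum>r<p+2. t r * M r p) > 0)}"

lemma length_signed_perms: "xs \<in> signed_perms m \<Longrightarrow> length xs = m"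
  unfolding signed_perms_def by (metis (mono_tags, lifting) card_lessThan distinct_card length_map mem_Collect_eq)

lemma finite_signed_perms: "finite (signed_perms m)"
proof (rule finite_subset)
  show "signed_perms m \<subseteq> {xs. set xs \<subseteq> {..<m} \<times> UNIV \<and> length xs = m}"
  proof
    fix xs assume xs: "xs \<in> signed_perms m"
    then have "fst ` set xs = {..<m}" by (simp add: signed_perms_def)
    then have "set xs \<subseteq> {..<m} \<times> UNIV" by (metis subset_fst_snd Sigma_mono subset_UNIV order_refl subset_trans)
    with length_signed_perms[OF xs] show "xs \<in> {xs. set xs \<subseteq> {..<m} \<times> UNIV \<and> length xs = m}"
      by simp
  qed
  show "finite {xs. set xs \<subseteq> {..<m} \<times> (UNIV :: bool set) \<and> length xs = m}"
    by (rule finite_lists_length_eq) auto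
qed

lemma signed_perms_map_flip: "map (apsnd Not) xs \<in> signed_perms m \<longleftrightarrow> xs \<in> signed_perms m"
  by (simp add: signed_perms_def image_image)

lemma flip_flip: "apsnd Not (apsnd Not z) = z"
  by (cases z) simp

lemma inj_on_flip: "inj_on (apsnd Not) X"
  by (metis flip_flip inj_onI)

lemma map_flip_flip: "map (apsnd Not) (map (apsnd Not) xs) = xs"
  by (simp add: flip_flip comp_def)

lemma signed_perms_mem_iff:
  assumes "xs \<in> signed_perms m" "i < m"
  shows "(i, False) \<in> set xs \<longleftrightarrow> (i, True) \<notin> set xs"
proof -
  have "i \<in> fst ` set xs" using assms by (auto simp: signed_perms_def)
  then obtain b where b: "(i, b) \<in> set xs" by auto
  have "inj_on fst (set xs)" using assms by (simp add: signed_perms_def distinct_map)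
  then have "\<not> ((i, True) \<in> set xs \<and> (i, False) \<in> set xs)"
    by (force simp: inj_on_def)
  with b show ?thesis by (cases b) auto
qed

lemma signed_perms_snoc:
  "xs @ [(m, b)] \<in> signed_perms (Suc m) \<longleftrightarrow> xs \<in> signed_perms m"
  unfolding signed_perms_def
  by (auto simp: lessThan_Suc)

text \<open>A solution on the facet opposite \<open>v\<close> has coefficient zero at
  \<open>v\<close>, so two simplices sharing this facet agree on whether it is positive.\<close>

lemma pos_facets_cong:
  assumes "\<And>r. r < p + 2 \<Longrightarrow> r \<noteq> v \<Longrightarrow> M r = M' r"
  shows "v \<in> pos_facets M p \<longleftrightarrow> v \<in> pos_facets M' p"
proof -
  have "(\<Sum>r<p+2. t r * M r a) = (\<Sum>r<p+2. t r * M' r a)" if "t v = 0" for t a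
  proof (rule sum.cong)
    fix r assume "r \<in> {..<p+2}"
    then show "t r * M r a = t r * M' r a" using assms[of r] that by (cases "r = v") auto
  qed simp
  then show ?thesis unfolding pos_facets_def nonneg_kernel_def by auto
qed

text \<open>Exchanges the maximal chain for the other one that agrees with it except in its \<open>v\<close>-th member.\<close>
definition pivot :: "nat \<Rightarrow> (nat \<times> bool) list \<times> nat \<Rightarrow> (nat \<times> bool) list \<times> nat" where
  "pivot p = (\<lambda>(xs, v). if v < p + 1 then (xs[v := xs ! Suc v, Suc v := xs ! v], v)
     else (xs[p + 1 := apsnd Not (xs ! (p + 1))], v))"

lemma pivot_involution:
  assumes "xs \<in> signed_perms (p + 2)" "v < p + 2"
  shows "pivot p (pivot p (xs, v)) = (xs, v)" "pivot p (xs, v) \<noteq> (xs, v)"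
proof -
  have l: "length xs = p + 2" using assms length_signed_perms by blast
  have d: "distinct xs" using assms by (simp add: signed_perms_def distinct_map)
  show "pivot p (pivot p (xs, v)) = (xs, v)"
  proof (cases "v < p + 1")
    case True
    then show ?thesis using l by (auto simp: pivot_def list_eq_iff_nth_eq nth_list_update)
  next
    case False
    then show ?thesis using l by (simp add: pivot_def flip_flip)
  qed
  show "pivot p (xs, v) \<noteq> (xs, v)"
  proof (cases "v < p + 1")
    case True
    have "xs ! v \<noteq> xs ! Suc v" using d l True by (simp add: nth_eq_iff_index_eq)
    then have "xs[v := xs ! Suc v, Suc v := xs ! v] ! Suc v \<noteq> xs ! Suc v" using l True by simp
    then show ?thesis using True unfolding pivot_def by auto
  next
    case False
    have "xs[p + 1 := apsnd Not (xs ! (p + 1))] ! (p + 1) \<noteq> xs ! (p + 1)"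
      using l by (cases "xs ! (p + 1)") auto
    then show ?thesis using False unfolding pivot_def by auto
  qed
qed

text \<open>Swapping entries \<open>v\<close> and \<open>Suc v\<close> changes only the prefix of
  length \<open>Suc v\<close>; flipping the last entry changes only the full set. Either way the
  sign of index \<open>p + 1\<close> is kept, unless that index is the last entry and is flipped:
  these are the facets on the equator.\<close>

lemma pivot_signed_perms:
  assumes "xs \<in> signed_perms (p + 2)" "v < p + 2" "pivot p (xs, v) = (ys, w)"
  shows "ys \<in> signed_perms (p + 2)" "w = v"
    "\<And>r. r < p + 2 \<Longrightarrow> r \<noteq> v \<Longrightarrow> chain_rows F ys r = chain_rows F xs r"
    "(p + 1, True) \<in> set xs \<Longrightarrow> \<not> (v = p + 1 \<and> fst (xs ! (p + 1)) = p + 1) \<Longrightarrow>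
      (p + 1, True) \<in> set ys \<and> \<not> (v = p + 1 \<and> fst (ys ! (p + 1)) = p + 1)"
proof -
  have l: "length xs = p + 2" using assms length_signed_perms by blast
  show "w = v" using assms(3) by (auto simp: pivot_def split: if_splits)
  have "ys \<in> signed_perms (p + 2) \<and> (\<forall>r. r < p + 2 \<longrightarrow> r \<noteq> v \<longrightarrow> chain_rows F ys r = chain_rows F xs r) \<and>
     ((p + 1, True) \<in> set xs \<longrightarrow> \<not> (v = p + 1 \<and> fst (xs ! (p + 1)) = p + 1) \<longrightarrow>
      (p + 1, True) \<in> set ys \<and> \<not> (v = p + 1 \<and> fst (ys ! (p + 1)) = p + 1))"
  proof (cases "v < p + 1")
    case True
    then have ys: "ys = xs[v := xs ! Suc v, Suc v := xs ! v]" using assms(3) by (auto simp: pivot_def)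
    have set: "set ys = set xs" unfolding ys using True l by (intro set_swap) auto
    have "map fst ys = (map fst xs)[v := map fst xs ! Suc v, Suc v := map fst xs ! v]"
      unfolding ys using True l by (simp add: map_update)
    then have "distinct (map fst ys)"
      using assms(1) True l distinct_swap[of v "map fst xs" "Suc v"] by (simp add: signed_perms_def)
    with set assms(1) have "ys \<in> signed_perms (p + 2)" by (simp add: signed_perms_def)
    moreover have "set (take (Suc r) ys) = set (take (Suc r) xs)" if "r < p + 2" "r \<noteq> v" for r
    proof (cases "r < v")
      case True
      then show ?thesis by (simp add: ys take_update_cancel)
    next
      case False
      with that have "v < r" by simp
      have "take (Suc r) ys = (take (Suc r) xs)[v := take (Suc r) xs ! Suc v, Suc v := take (Suc r) xs ! v]"
        using \<open>v < r\<close> by (simp add: ys take_update_swap)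
      then show ?thesis using l that \<open>v < r\<close> by (simp only:) (rule set_swap; simp)
    qed
    ultimately show ?thesis using set True by (simp add: chain_rows_def)
  next
    case False
    then have v: "v = p + 1" using assms by simp
    then have ys: "ys = xs[p + 1 := apsnd Not (xs ! (p + 1))]" using assms(3) by (auto simp: pivot_def)
    have mf: "map fst ys = map fst xs"
      unfolding ys using l by (simp add: map_update) (metis list_update_id length_map lessI nth_map)
    then have "ys \<in> signed_perms (p + 2)" using assms(1)
      unfolding signed_perms_def by (simp only: mem_Collect_eq)
    moreover have "chain_rows F ys r = chain_rows F xs r" if "r < p + 2" "r \<noteq> v" for r
      using that v by (simp add: chain_rows_def ys take_update_cancel)
    moreover have "(p + 1, True) \<in> set ys"
      if mem: "(p + 1, True) \<in> set xs" and last: "fst (xs ! (p + 1)) \<noteq> p + 1"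
    proof -
      obtain i where i: "i < length xs" "xs ! i = (p + 1, True)"
        using mem in_set_conv_nth[of "(p + 1, True)" xs] by blast
      then have "i \<noteq> p + 1" using last by auto
      then have "ys ! i = (p + 1, True)" "i < length ys" using i by (auto simp: ys)
      then show ?thesis by (metis nth_mem)
    qed
    moreover have "fst (ys ! (p + 1)) = fst (xs ! (p + 1))" using l by (simp add: ys)
    ultimately show ?thesis using v by auto
  qed
  then show "ys \<in> signed_perms (p + 2)"
    "\<And>r. r < p + 2 \<Longrightarrow> r \<noteq> v \<Longrightarrow> chain_rows F ys r = chain_rows F xs r"
    "(p + 1, True) \<in> set xs \<Longrightarrow> \<not> (v = p + 1 \<and> fst (xs ! (p + 1)) = p + 1) \<Longrightarrow>
      (p + 1, True) \<in> set ys \<and> \<not> (v = p + 1 \<and> fst (ys ! (p + 1)) = p + 1)" by blast+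
qed

section \<open>A piecewise linear Borsuk-Ulam theorem\<close>

text \<open>All \<open>m \<le> N\<close> are included because the induction runs through the nested
  equators. Oddness is asked only on chain members: a set with both signs of an index can equal its
  own flip, where an odd map would have to vanish.\<close>

locale generic_odd_map =
  fixes F :: "(nat \<times> bool) set \<Rightarrow> nat \<Rightarrow> real" and N :: nat
  assumes odd_rows: "\<And>m xs r a. m \<le> N \<Longrightarrow> xs \<in> signed_perms m \<Longrightarrow> r < m \<Longrightarrow>
      chain_rows F (map (apsnd Not) xs) r a = - chain_rows F xs r a"
    and generic: "\<And>m xs. m \<le> N \<Longrightarrow> xs \<in> signed_perms m \<Longrightarrow> generic_rows (chain_rows F xs) m"
begin

text \<open>The simplices of the upper hemisphere of the \<open>p\<close>-sphere that contain a zero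
  of the first \<open>p\<close> coordinates. The hemisphere is the one where index \<open>p\<close>
  has positive sign.\<close>

definition zeros :: "nat \<Rightarrow> (nat \<times> bool) list set" where
  "zeros p = {xs \<in> signed_perms (p + 1). (p, True) \<in> set xs \<and>
     (\<exists>t. nonneg_kernel (chain_rows F xs) (p + 1) p t)}"

definition pos_ray :: "nat \<Rightarrow> (nat \<times> bool) list \<Rightarrow> bool" where
  "pos_ray p xs \<longleftrightarrow> (\<exists>t. nonneg_kernel (chain_rows F xs) (p + 1) p t \<and> (\<Sum>r<p+1. t r * chain_rows F xs r p) > 0)"

definition neg_ray :: "nat \<Rightarrow> (nat \<times> bool) list \<Rightarrow> bool" where
  "neg_ray p xs \<longleftrightarrow> (\<exists>t. nonneg_kernel (chain_rows F xs) (p + 1) p t \<and> (\<Sum>r<p+1. t r * chain_rows F xs r p) < 0)"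

lemma pos_ray_flip:
  assumes "p + 1 \<le> N" "xs \<in> signed_perms (p + 1)"
  shows "pos_ray p (map (apsnd Not) xs) \<longleftrightarrow> neg_ray p xs"
proof -
  have "(\<Sum>r<p+1. t r * chain_rows F (map (apsnd Not) xs) r a) = - (\<Sum>r<p+1. t r * chain_rows F xs r a)" for t a
    unfolding sum_negf[symmetric] using odd_rows[OF assms] by (intro sum.cong) auto
  then show ?thesis
    unfolding pos_ray_def neg_ray_def nonneg_kernel_def
    by (simp only: neg_equal_0_iff_equal neg_0_less_iff_less)
qed

text \<open>By genericity, \<open>p + 1\<close> rows have no common solution for
  \<open>p + 1\<close> columns. So the last coordinate is nonzero on every solution, and it cannot
  take both signs, since a positive combination would then cancel it.\<close>

lemma ray_dichotomy:
  assumes N: "p + 1 \<le> N" and xs: "xs \<in> signed_perms (p + 1)"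
  shows "(\<exists>t. nonneg_kernel (chain_rows F xs) (p + 1) p t) \<longleftrightarrow> pos_ray p xs \<or> neg_ray p xs"
    and "\<not> (pos_ray p xs \<and> neg_ray p xs)"
proof -
  note gen = generic[OF N xs]
  have ne: "(\<Sum>r<p+1. t r * chain_rows F xs r p) \<noteq> 0" if t: "nonneg_kernel (chain_rows F xs) (p + 1) p t" for t
  proof
    assume "(\<Sum>r<p+1. t r * chain_rows F xs r p) = 0"
    with t have "\<forall>a<p+1. (\<Sum>r<p+1. t r * chain_rows F xs r a) = 0"
      unfolding nonneg_kernel_def by (auto simp: less_Suc_eq)
    then have "t r = 0" if "r < p + 1" for r
      using generic_kernel_zero[OF gen, of "{}" "p + 1" t r] that by auto
    with t show False unfolding nonneg_kernel_def by force
  qed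
  then show "(\<exists>t. nonneg_kernel (chain_rows F xs) (p + 1) p t) \<longleftrightarrow> pos_ray p xs \<or> neg_ray p xs"
    unfolding pos_ray_def neg_ray_def by (meson linorder_neqE_linordered_idom)
  show "\<not> (pos_ray p xs \<and> neg_ray p xs)"
  proof
    assume "pos_ray p xs \<and> neg_ray p xs"
    then obtain s t where s: "nonneg_kernel (chain_rows F xs) (p + 1) p s" "(\<Sum>r<p+1. s r * chain_rows F xs r p) > 0"
      and t: "nonneg_kernel (chain_rows F xs) (p + 1) p t" "(\<Sum>r<p+1. t r * chain_rows F xs r p) < 0"
      unfolding pos_ray_def neg_ray_def by blast
    define c where "c = (\<Sum>r<p+1. s r * chain_rows F xs r p)"
    define d where "d = - (\<Sum>r<p+1. t r * chain_rows F xs r p)"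
    have cd: "c > 0" "d > 0" using s t by (auto simp: c_def d_def)
    let ?h = "\<lambda>r. d * s r + c * t r"
    have lin: "(\<Sum>r<p+1. ?h r * chain_rows F xs r a) =
        d * (\<Sum>r<p+1. s r * chain_rows F xs r a) + c * (\<Sum>r<p+1. t r * chain_rows F xs r a)" for a
      by (simp add: algebra_simps sum.distrib sum_distrib_left)
    have "(\<Sum>r<p+1. ?h r * chain_rows F xs r p) = 0"
    proof -
      have "(\<Sum>r<p+1. t r * chain_rows F xs r p) = - d" by (simp add: d_def)
      then show ?thesis unfolding lin c_def[symmetric] by simp
    qed
    moreover have "(\<Sum>r<p+1. ?h r * chain_rows F xs r a) = 0" if "a < p" for a
      unfolding lin using s t that by (simp add: nonneg_kernel_def)
    moreover have "\<forall>r<p+1. ?h r \<ge> 0"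
      using s t cd by (simp add: nonneg_kernel_def)
    moreover have "\<exists>r<p+1. ?h r > 0"
    proof -
      obtain r where "r < p + 1" "s r > 0" using s unfolding nonneg_kernel_def by auto
      moreover from this have "t r \<ge> 0" using t unfolding nonneg_kernel_def by auto
      ultimately show ?thesis using cd by (intro exI[of _ r]) (simp add: add_pos_nonneg)
    qed
    ultimately have "nonneg_kernel (chain_rows F xs) (p + 1) p ?h" unfolding nonneg_kernel_def by blast
    with \<open>(\<Sum>r<p+1. ?h r * chain_rows F xs r p) = 0\<close> ne show False by blast
  qed
qed

text \<open>The antipodal map exchanges the hemispheres and the two rays. Simplices on the whole
  sphere meeting the positive ray thus correspond to upper ones meeting either ray, which are those
  containing a zero.\<close>

lemma card_pos_ray:
  assumes N: "p + 1 \<le> N"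
  shows "card {xs \<in> signed_perms (p + 1). pos_ray p xs} = card (zeros p)"
proof -
  let ?S = "signed_perms (p + 1)" and ?f = "map (apsnd Not)"
  let ?P = "{xs \<in> ?S. (p, True) \<in> set xs \<and> pos_ray p xs}"
  let ?Q = "{xs \<in> ?S. (p, True) \<notin> set xs \<and> pos_ray p xs}"
  let ?R = "{xs \<in> ?S. (p, True) \<in> set xs \<and> neg_ray p xs}"
  have fin: "finite ?P" "finite ?Q" "finite ?R" using finite_signed_perms by auto
  have mem: "(p, True) \<in> set (?f xs) \<longleftrightarrow> (p, True) \<notin> set xs" if "xs \<in> ?S" for xs
  proof -
    have "(p, True) \<in> set (?f xs) \<longleftrightarrow> (p, False) \<in> set xs" by force
    then show ?thesis using signed_perms_mem_iff[OF that, of p] by simp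
  qed
  have "bij_betw ?f ?R ?Q"
  proof (rule bij_betw_byWitness[where f' = ?f])
    show "\<forall>a\<in>?R. ?f (?f a) = a" "\<forall>a\<in>?Q. ?f (?f a) = a" using map_flip_flip by blast+
    show "?f ` ?R \<subseteq> ?Q" using pos_ray_flip[OF N] mem signed_perms_map_flip by blast
    show "?f ` ?Q \<subseteq> ?R"
    proof
      fix ys assume "ys \<in> ?f ` ?Q"
      then obtain xs where xs: "ys = ?f xs" "xs \<in> ?S" "(p, True) \<notin> set xs" "pos_ray p xs" by blast
      then have ys: "ys \<in> ?S" using signed_perms_map_flip by blast
      have "neg_ray p ys" using pos_ray_flip[OF N ys] xs map_flip_flip by metis
      then show "ys \<in> ?R" using ys mem xs by blast
    qed
  qed
  then have RQ: "card ?R = card ?Q" by (rule bij_betw_same_card)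
  have "{xs \<in> ?S. pos_ray p xs} = ?P \<union> ?Q" by blast
  then have "card {xs \<in> ?S. pos_ray p xs} = card ?P + card ?Q"
    using fin by (simp only:) (subst card_Un_disjoint; auto)
  also have "\<dots> = card (?P \<union> ?R)"
    unfolding RQ[symmetric] using fin ray_dichotomy(2)[OF N] by (subst card_Un_disjoint) auto
  also have "?P \<union> ?R = zeros p"
    unfolding zeros_def using ray_dichotomy(1)[OF N] by blast
  finally show ?thesis .
qed

text \<open>The facet opposite the full set is the simplex of \<open>xs\<close>, which lies on the
  equator.\<close>

lemma pos_facet_last:
  assumes "xs \<in> signed_perms (p + 1)"
  shows "p + 1 \<in> pos_facets (chain_rows F (xs @ [(p + 1, True)])) p \<longleftrightarrow> pos_ray p xs"
proof -
  let ?ys = "xs @ [(p + 1, True)]"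
  have l: "length xs = p + 1" using assms length_signed_perms by blast
  have r: "chain_rows F ?ys r = chain_rows F xs r" if "r < p + 1" for r
    using that l by (simp add: chain_rows_def)
  have e: "(\<Sum>r<p+2. t r * chain_rows F ?ys r a) = (\<Sum>r<p+1. t r * chain_rows F xs r a)" if "t (p + 1) = 0" for t a
  proof -
    have "(\<Sum>r<p+2. t r * chain_rows F ?ys r a) = (\<Sum>r<p+1. t r * chain_rows F ?ys r a)"
      using that by simp
    also have "\<dots> = (\<Sum>r<p+1. t r * chain_rows F xs r a)"
      using r by (intro sum.cong) auto
    finally show ?thesis .
  qed
  have k: "nonneg_kernel (chain_rows F ?ys) (p + 2) p t \<longleftrightarrow> nonneg_kernel (chain_rows F xs) (p + 1) p t"
    if "t (p + 1) = 0" for t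
    unfolding nonneg_kernel_def e[where t = t, OF that] using that by (auto simp: less_Suc_eq)
  show ?thesis
  proof
    assume "p + 1 \<in> pos_facets (chain_rows F ?ys) p"
    then show "pos_ray p xs" unfolding pos_facets_def pos_ray_def using k e by fastforce
  next
    assume "pos_ray p xs"
    then obtain t where t: "nonneg_kernel (chain_rows F xs) (p + 1) p t" "(\<Sum>r<p+1. t r * chain_rows F xs r p) > 0"
      unfolding pos_ray_def by blast
    \<comment> \<open>The value \<open>t (p + 1)\<close> is unconstrained for \<open>xs\<close> but
      counts for the longer chain, so it is reset.\<close>
    let ?t = "t(p + 1 := 0)"
    have "(\<Sum>r<p+1. ?t r * chain_rows F xs r a) = (\<Sum>r<p+1. t r * chain_rows F xs r a)" for a
      by (intro sum.cong) auto
    moreover have "\<exists>r<p+1. ?t r > 0"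
      using t(1) unfolding nonneg_kernel_def by (metis fun_upd_other nat_neq_iff)
    ultimately have "nonneg_kernel (chain_rows F xs) (p + 1) p ?t" "(\<Sum>r<p+1. ?t r * chain_rows F xs r p) > 0"
      using t unfolding nonneg_kernel_def by auto
    then have "nonneg_kernel (chain_rows F ?ys) (p + 2) p ?t" "(\<Sum>r<p+2. ?t r * chain_rows F ?ys r p) > 0"
      using k[of ?t] e[of ?t p] by auto
    then show "p + 1 \<in> pos_facets (chain_rows F ?ys) p"
      unfolding pos_facets_def by (intro CollectI conjI exI[of _ ?t]) auto
  qed
qed

text \<open>Double counting modulo 2 of the pairs \<open>Q\<close> of an upper simplex and a
  positive facet: by simplices it gives the zeros in dimension \<open>p + 1\<close>, by facets only
  the equatorial pairs \<open>B\<close> survive.\<close>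

lemma odd_zeros_step:
  assumes N: "p + 2 \<le> N"
  shows "odd (card (zeros (p + 1))) \<longleftrightarrow> odd (card (zeros p))"
proof -
  define L where "L = {xs \<in> signed_perms (p + 2). (p + 1, True) \<in> set xs}"
  define Q where "Q = Sigma L (\<lambda>xs. pos_facets (chain_rows F xs) p)"
  define B where "B = {(xs, v) \<in> Q. v = p + 1 \<and> fst (xs ! (p + 1)) = p + 1}"
  have finL: "finite L" using finite_signed_perms unfolding L_def by auto
  have finf: "finite (pos_facets M p)" for M unfolding pos_facets_def by simp
  have finQ: "finite Q" unfolding Q_def using finL finf by auto
  have zeros: "zeros (p + 1) = {xs \<in> L. odd (card (pos_facets (chain_rows F xs) p))}"
    unfolding zeros_def L_def pos_facets_def
    using facet_parity generic[OF N] by (auto simp: numeral_2_eq_2)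
  have "card Q = (\<Sum>xs\<in>L. card (pos_facets (chain_rows F xs) p))"
    unfolding Q_def using finL finf by (simp add: card_SigmaI)
  then have "odd (card Q) \<longleftrightarrow> odd (card (zeros (p + 1)))"
    unfolding zeros using even_sum_iff[OF finL] by simp
  \<comment> \<open>Each facet off the equator lies in exactly two upper simplices, which
    \<open>pivot\<close> exchanges.\<close>
  moreover have "even (card (Q - B))"
  proof (rule even_card_involution[where f = "pivot p"])
    show "finite (Q - B)" using finQ by simp
    fix z assume z: "z \<in> Q - B"
    obtain xs v where xv: "z = (xs, v)" by (cases z)
    obtain ys w where yw: "pivot p (xs, v) = (ys, w)" by (cases "pivot p (xs, v)")
    have xs: "xs \<in> signed_perms (p + 2)" "(p + 1, True) \<in> set xs" "v < p + 2"
      "v \<in> pos_facets (chain_rows F xs) p" "\<not> (v = p + 1 \<and> fst (xs ! (p + 1)) = p + 1)"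
      using z unfolding xv Q_def L_def B_def pos_facets_def by auto
    note piv = pivot_signed_perms[OF xs(1,3) yw]
    have "v \<in> pos_facets (chain_rows F ys) p"
      using pos_facets_cong[of p v "chain_rows F ys" "chain_rows F xs"] piv(3) xs(4) by blast
    then show "pivot p z \<in> Q - B"
      using piv(1,2,4) xs unfolding xv yw Q_def L_def B_def by auto
    show "pivot p (pivot p z) = z" "pivot p z \<noteq> z"
      using pivot_involution[OF xs(1,3)] unfolding xv by blast+
  qed
  \<comment> \<open>Such a pair is a chain ending with the positive index \<open>p + 1\<close>;
    removing that entry leaves a simplex of the equator meeting the positive ray.\<close>
  moreover have "card B = card (zeros p)"
  proof -
    let ?g = "\<lambda>xs. (xs @ [(p + 1, True)], p + 1)"
    have "bij_betw ?g {xs \<in> signed_perms (p + 1). pos_ray p xs} B"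
    proof (rule bij_betwI')
      fix xs assume "xs \<in> {xs \<in> signed_perms (p + 1). pos_ray p xs}"
      then have xs: "xs \<in> signed_perms (p + 1)" "pos_ray p xs" by auto
      then have "xs @ [(p + 1, True)] \<in> signed_perms (p + 2)"
        using signed_perms_snoc[of xs "p + 1" True] by simp
      moreover have "(xs @ [(p + 1, True)]) ! (p + 1) = (p + 1, True)"
        using length_signed_perms[OF xs(1)] by (simp add: nth_append)
      ultimately show "?g xs \<in> B"
        using pos_facet_last[OF xs(1)] xs unfolding B_def Q_def L_def by auto
    next
      fix z assume "z \<in> B"
      then obtain ys where z: "z = (ys, p + 1)" and ys: "ys \<in> signed_perms (p + 2)"
        "(p + 1, True) \<in> set ys" "p + 1 \<in> pos_facets (chain_rows F ys) p" "fst (ys ! (p + 1)) = p + 1"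
        unfolding B_def Q_def L_def by auto
      have l: "length ys = p + 2" using ys length_signed_perms by blast
      have "ys ! (p + 1) \<in> set ys" using l by simp
      moreover have "inj_on fst (set ys)" using ys by (simp add: signed_perms_def distinct_map)
      ultimately have last: "ys ! (p + 1) = (p + 1, True)"
        using ys inj_onD[of fst "set ys" "ys ! (p + 1)" "(p + 1, True)"] by simp
      define xs where "xs = take (p + 1) ys"
      have e: "ys = xs @ [(p + 1, True)]"
        unfolding xs_def using take_Suc_conv_app_nth[of "p + 1" ys] l last by simp
      have xs: "xs \<in> signed_perms (p + 1)" using ys(1) signed_perms_snoc[of xs "p + 1" True] e by simp
      then have "pos_ray p xs" using pos_facet_last ys(3) e by simp
      with xs show "\<exists>x\<in>{xs \<in> signed_perms (p + 1). pos_ray p xs}. z = ?g x"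
        using z e by blast
    qed simp
    then show ?thesis using card_pos_ray[of p] N bij_betw_same_card by fastforce
  qed
  moreover have "card Q = card (Q - B) + card B"
  proof -
    have "B \<subseteq> Q" unfolding B_def by blast
    then show ?thesis
      using finQ card_Diff_subset[of B Q] card_mono[of Q B] finite_subset[of B Q] by simp
  qed
  ultimately show ?thesis by auto
qed

lemma odd_zeros: "p + 1 \<le> N \<Longrightarrow> odd (card (zeros p))"
proof (induction p)
  case 0
  \<comment> \<open>The 0-sphere has two points and there are no equations, so its upper point is
    the only zero counted.\<close>
  have "signed_perms 1 = {[(0, b)] | b. True}"
  proof (intro equalityI subsetI)
    fix xs assume xs: "xs \<in> signed_perms 1"
    then obtain z where "xs = [z]" using length_signed_perms[of xs 1] by (auto simp: length_Suc_conv)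
    with xs show "xs \<in> {[(0, b)] | b. True}" by (cases z) (auto simp: signed_perms_def)
  qed (auto simp: signed_perms_def)
  then have "zeros 0 = {[(0, True)]}"
    unfolding zeros_def by (auto simp: nonneg_kernel_def intro: exI[of _ "\<lambda>_. 1"])
  then show ?case by simp
next
  case (Suc p)
  then show ?case using odd_zeros_step[of p] by simp
qed

end

section \<open>Generic odd perturbations and passage to the limit\<close>

text \<open>Choose the rows one at a time. Each set \<open>S\<close> of earlier rows, cut to
  \<open>card S + 1\<close> columns, lies in a hyperplane through 0, and the new row only has to
  avoid these finitely many hyperplanes. Moving it along a moment curve meets each of them finitely
  often.\<close>

lemma generic_perturbation:
  fixes f :: "'a \<Rightarrow> nat \<Rightarrow> real"
  assumes "finite R" "e > 0"
  shows "\<exists>g. (\<forall>x\<in>R. \<forall>a. \<bar>g x a - f x a\<bar> \<le> e) \<and>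
     (\<forall>S\<subseteq>R. \<forall>t. (\<forall>a<card S. (\<Sum>x\<in>S. t x * g x a) = 0) \<longrightarrow> (\<forall>x\<in>S. t x = 0))"
  using assms
proof (induction R rule: finite_induct)
  case empty
  then show ?case by auto
next
  case (insert x R)
  from insert.IH[OF insert.prems] obtain g where g1: "\<forall>x\<in>R. \<forall>a. \<bar>g x a - f x a\<bar> \<le> e"
    and g2: "\<forall>S\<subseteq>R. \<forall>t. (\<forall>a<card S. (\<Sum>x\<in>S. t x * g x a) = 0) \<longrightarrow> (\<forall>x\<in>S. t x = 0)"
    by (elim exE conjE)
  have g: "\<forall>x\<in>R. \<forall>a. \<bar>g x a - f x a\<bar> \<le> e"
    "\<And>S t. S \<subseteq> R \<Longrightarrow> (\<forall>a<card S. (\<Sum>x\<in>S. t x * g x a) = 0) \<Longrightarrow> (\<forall>x\<in>S. t x = 0)"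
    using g1 g2 by simp_all
  have "\<exists>c. (\<exists>a\<in>{..card S}. c a \<noteq> 0) \<and> (\<forall>y\<in>S. (\<Sum>a\<in>{..card S}. c a * g y a) = 0)" if "S \<subseteq> R" for S
    using homogeneous_system_nontrivial[of S "{..card S}" "\<lambda>a y. g y a"]
      finite_subset[OF that insert.hyps(1)] by auto
  then have "\<forall>S. \<exists>c. S \<subseteq> R \<longrightarrow> (\<exists>a\<in>{..card S}. c a \<noteq> 0) \<and> (\<forall>y\<in>S. (\<Sum>a\<in>{..card S}. c a * g y a) = 0)"
    by blast
  then obtain c where c: "\<And>S. S \<subseteq> R \<Longrightarrow> \<exists>a\<le>card S. c S a \<noteq> 0"
    "\<And>S y. S \<subseteq> R \<Longrightarrow> y \<in> S \<Longrightarrow> (\<Sum>a\<le>card S. c S a * g y a) = 0"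
    by (metis atMost_iff)
  let ?bad = "\<lambda>S. {\<epsilon>. (\<Sum>a\<le>card S. c S a * (f x a + \<epsilon> ^ Suc a)) = 0}"
  have "finite (?bad S)" if "S \<subseteq> R" for S
  proof -
    \<comment> \<open>Coefficients of the hyperplane condition as a polynomial in the perturbation
      parameter. Some \<open>c S a\<close> is nonzero, so the polynomial is too.\<close>
    define d where "d i = (case i of 0 \<Rightarrow> \<Sum>a\<le>card S. c S a * f x a | Suc a \<Rightarrow> c S a)" for i
    have "(\<Sum>i\<le>Suc (card S). d i * \<epsilon> ^ i) = (\<Sum>a\<le>card S. c S a * (f x a + \<epsilon> ^ Suc a))" for \<epsilon>
      by (subst sum.atMost_Suc_shift) (simp add: d_def sum.distrib distrib_left)
    moreover have "\<exists>i\<le>Suc (card S). d i \<noteq> 0"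
    proof -
      obtain a where "a \<le> card S" "c S a \<noteq> 0" using c(1)[OF \<open>S \<subseteq> R\<close>] by blast
      then show ?thesis by (intro exI[of _ "Suc a"]) (simp add: d_def)
    qed
    ultimately show ?thesis
      using polyfun_finite_roots[of d "Suc (card S)"] by simp
  qed
  then have "finite (\<Union>S\<in>Pow R. ?bad S)" using insert.hyps by auto
  moreover have "infinite {0<..min e 1}" using insert.prems by (simp add: infinite_Ioc)
  ultimately have "\<not> {0<..min e 1} \<subseteq> (\<Union>S\<in>Pow R. ?bad S)"
    by (meson finite_subset)
  \<comment> \<open>The bound 1 ensures that all powers of \<open>\<epsilon>\<close> are at most
    \<open>\<epsilon>\<close>, hence at most \<open>e\<close>.\<close>
  then obtain \<epsilon> where \<epsilon>: "\<epsilon> \<in> {0<..min e 1}" "\<epsilon> \<notin> (\<Union>S\<in>Pow R. ?bad S)"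
    by (meson subsetI)
  define h where "h = g(x := \<lambda>a. f x a + \<epsilon> ^ Suc a)"
  have hg: "h y = g y" if "y \<in> R" for y using that insert.hyps by (auto simp: h_def)
  have "\<bar>h y a - f y a\<bar> \<le> e" if "y \<in> insert x R" for y a
  proof (cases "y = x")
    case True
    have "\<epsilon> ^ Suc a \<le> \<epsilon>" using \<epsilon> by (simp add: mult_left_le power_le_one)
    also have "\<epsilon> \<le> e" using \<epsilon> by simp
    finally show ?thesis using True \<epsilon> by (simp add: h_def)
  next
    case False
    then show ?thesis using that g hg by auto
  qed
  moreover have "\<forall>y\<in>S. t y = 0"
    if S: "S \<subseteq> insert x R" and t: "\<forall>a<card S. (\<Sum>y\<in>S. t y * h y a) = 0" for S t
  proof (cases "x \<in> S")
    case False
    then have "S \<subseteq> R" using S by blast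
    moreover from this have "(\<Sum>y\<in>S. t y * h y a) = (\<Sum>y\<in>S. t y * g y a)" for a
      using hg by (intro sum.cong) auto
    ultimately show ?thesis using g(2)[of S t] t by auto
  next
    case True
    let ?S = "S - {x}"
    have SR: "?S \<subseteq> R" using S by blast
    have finS: "finite S" using S insert.hyps finite_subset by blast
    have cS: "card S = Suc (card ?S)" using True finS by (metis card.remove)
    have split: "(\<Sum>y\<in>S. t y * h y a) = t x * h x a + (\<Sum>y\<in>?S. t y * g y a)" for a
      using True finS hg SR by (subst sum.remove[of _ x]) (auto intro!: sum.cong)
    \<comment> \<open>Apply the hyperplane functional to the relation: it kills the earlier rows and
      leaves \<open>t x\<close> times a nonzero number.\<close>
    have "0 = (\<Sum>a\<le>card ?S. c ?S a * (\<Sum>y\<in>S. t y * h y a))"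
      using t cS by simp
    also have "\<dots> = (\<Sum>a\<le>card ?S. t x * (c ?S a * h x a)) + (\<Sum>a\<le>card ?S. \<Sum>y\<in>?S. t y * (c ?S a * g y a))"
      unfolding split by (simp add: sum.distrib sum_distrib_left algebra_simps)
    also have "(\<Sum>a\<le>card ?S. \<Sum>y\<in>?S. t y * (c ?S a * g y a)) = (\<Sum>y\<in>?S. \<Sum>a\<le>card ?S. t y * (c ?S a * g y a))"
      by (rule sum.swap)
    also have "\<dots> = 0"
      unfolding sum_distrib_left[symmetric] using c(2)[OF SR] by (intro sum.neutral) simp
    also have "(\<Sum>a\<le>card ?S. t x * (c ?S a * h x a)) + 0 = t x * (\<Sum>a\<le>card ?S. c ?S a * h x a)"
      by (simp add: sum_distrib_left)
    finally have "t x * (\<Sum>a\<le>card ?S. c ?S a * (f x a + \<epsilon> ^ Suc a)) = 0" by (simp add: h_def)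
    then have tx: "t x = 0" using \<epsilon>(2) SR by auto
    then have "\<forall>a<card ?S. (\<Sum>y\<in>?S. t y * g y a) = 0"
      using t split cS by auto
    then show ?thesis using g(2)[OF SR] tx by blast
  qed
  ultimately show ?case by blast
qed

text \<open>Bolzano-Weierstrass, one coordinate at a time.\<close>

lemma pointwise_convergent_subsequence:
  fixes T :: "nat \<Rightarrow> 'a \<Rightarrow> real"
  assumes "finite S" "\<And>n x. x \<in> S \<Longrightarrow> \<bar>T n x\<bar> \<le> B"
  shows "\<exists>r l. strict_mono (r :: nat \<Rightarrow> nat) \<and> (\<forall>x\<in>S. (\<lambda>n. T (r n) x) \<longlonglongrightarrow> l x)"
  using assms
proof (induction S rule: finite_induct)
  case empty
  then show ?case by (auto intro: strict_mono_id)
next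
  case (insert x S)
  then obtain r l where r: "strict_mono (r :: nat \<Rightarrow> nat)" "\<forall>x\<in>S. (\<lambda>n. T (r n) x) \<longlonglongrightarrow> l x"
    by auto
  have "bounded (range (\<lambda>n. T (r n) x))"
    using insert.prems by (intro boundedI[of _ B]) auto
  then obtain L q where q: "strict_mono (q :: nat \<Rightarrow> nat)" "((\<lambda>n. T (r n) x) \<circ> q) \<longlonglongrightarrow> L"
    using bounded_imp_convergent_subsequence by blast
  have "strict_mono (r \<circ> q)" using r q by (simp add: strict_mono_o)
  moreover have "(\<lambda>n. T ((r \<circ> q) n) y) \<longlonglongrightarrow> (l(x := L)) y" if "y \<in> insert x S" for y
  proof (cases "y = x")
    case True
    then show ?thesis using q by (simp add: comp_def)
  next
    case False
    then have "((\<lambda>n. T (r n) y) \<circ> q) \<longlonglongrightarrow> l y"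
      using that r q by (intro LIMSEQ_subseq_LIMSEQ) auto
    then show ?thesis using False by (simp add: comp_def)
  qed
  ultimately show ?case by blast
qed

text \<open>A transversal of the antipodal pairs.\<close>
definition upper :: "(nat \<times> bool) set \<Rightarrow> bool" where
  "upper X \<longleftrightarrow> (Min (fst ` X), True) \<in> X"

text \<open>A chain member contains its smallest index with exactly one sign.\<close>

lemma upper_flip:
  assumes xs: "xs \<in> signed_perms m" and "r < m" and X: "X = set (take (Suc r) xs)"
  shows "upper (apsnd Not ` X) \<longleftrightarrow> \<not> upper X"
proof -
  have l: "length xs = m" using xs length_signed_perms by blast
  then have "X \<noteq> {}" "finite X" using X assms(2) by auto
  define i where "i = Min (fst ` X)"
  have "i \<in> fst ` X" using \<open>X \<noteq> {}\<close> \<open>finite X\<close> unfolding i_def by (intro Min_in) auto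
  then obtain b where b: "(i, b) \<in> X" by auto
  have sub: "X \<subseteq> set xs" using X by (simp add: set_take_subset)
  then have "i < m" using b xs unfolding signed_perms_def by force
  then have "(i, False) \<in> X \<longleftrightarrow> (i, True) \<notin> X"
    using signed_perms_mem_iff[OF xs \<open>i < m\<close>] sub b by (cases b) auto
  moreover have "(i, True) \<in> apsnd Not ` X \<longleftrightarrow> (i, False) \<in> X" by force
  moreover have "fst ` apsnd Not ` X = fst ` X" by (simp add: image_image)
  ultimately show ?thesis by (simp add: upper_def i_def)
qed

lemma chain_rows_map_flip: "chain_rows F (map (apsnd Not) xs) r = F (apsnd Not ` set (take (Suc r) xs))"
  by (simp add: chain_rows_def take_map)

text \<open>Perturb freely, then keep only the values on upper sets and extend them oddly. Along a
  chain the rows are, up to sign, values of \<open>g\<close> at distinct sets, so genericity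
  survives; oddness of \<open>F\<close> preserves the error bound.\<close>

lemma generic_odd_approximation:
  fixes F :: "(nat \<times> bool) set \<Rightarrow> nat \<Rightarrow> real"
  assumes odd: "\<And>X a. F (apsnd Not ` X) a = - F X a" and "e > 0"
  obtains G where "generic_odd_map G n"
    "\<And>xs r a. xs \<in> signed_perms n \<Longrightarrow> r < n \<Longrightarrow> \<bar>chain_rows G xs r a - chain_rows F xs r a\<bar> \<le> e"
proof -
  define R where "R = Pow ({..<n} \<times> (UNIV :: bool set))"
  have "finite R" unfolding R_def by simp
  from generic_perturbation[OF this \<open>e > 0\<close>, of F] obtain g where
    g1: "\<forall>x\<in>R. \<forall>a. \<bar>g x a - F x a\<bar> \<le> e"
    and g2: "\<forall>S\<subseteq>R. \<forall>t. (\<forall>a<card S. (\<Sum>x\<in>S. t x * g x a) = 0) \<longrightarrow> (\<forall>x\<in>S. t x = 0)"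
    by (elim exE conjE)
  have g: "\<forall>x\<in>R. \<forall>a. \<bar>g x a - F x a\<bar> \<le> e"
    "\<And>S t. S \<subseteq> R \<Longrightarrow> (\<forall>a<card S. (\<Sum>x\<in>S. t x * g x a) = 0) \<Longrightarrow> (\<forall>x\<in>S. t x = 0)"
    using g1 g2 by simp_all
  define \<sigma> where "\<sigma> X = (if upper X then 1 else - 1 :: real)" for X
  define q where "q X = (if upper X then X else apsnd Not ` X)" for X
  define G where "G X a = \<sigma> X * g (q X) a" for X a
  have ff: "apsnd Not ` apsnd Not ` X = X" for X :: "(nat \<times> bool) set"
    by (simp add: image_image flip_flip)
  have inR: "q (set (take (Suc r) xs)) \<in> R" if "xs \<in> signed_perms m" "m \<le> n" for xs m r
  proof -
    have "set (take (Suc r) xs) \<subseteq> set xs" by (rule set_take_subset)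
    moreover have "fst ` set xs \<subseteq> {..<n}" using that by (auto simp: signed_perms_def)
    ultimately have "fst ` q (set (take (Suc r) xs)) \<subseteq> {..<n}"
      unfolding q_def by (auto simp: image_image)
    then show ?thesis unfolding R_def by force
  qed
  have "generic_odd_map G n"
  proof
    fix m xs r a
    assume A: "m \<le> n" "xs \<in> signed_perms m" "r < m"
    let ?X = "set (take (Suc r) xs)"
    show "chain_rows G (map (apsnd Not) xs) r a = - chain_rows G xs r a"
      unfolding chain_rows_map_flip unfolding chain_rows_def G_def \<sigma>_def q_def
      using upper_flip[OF A(2,3) refl] ff by auto
  next
    fix m xs
    assume A: "m \<le> n" "xs \<in> signed_perms m"
    have l: "length xs = m" using A length_signed_perms by blast
    have d: "distinct xs" using A by (simp add: signed_perms_def distinct_map)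
    define h where "h r = q (set (take (Suc r) xs))" for r
    \<comment> \<open>Flipping preserves cardinality, so the representatives of different chain
      members are different.\<close>
    have ch: "card (h r) = Suc r" if "r < m" for r
    proof -
      have "card (set (take (Suc r) xs)) = Suc r"
        using d l that by (simp add: distinct_card)
      then show ?thesis unfolding h_def q_def
        by (simp add: card_image[OF inj_on_flip])
    qed
    show "generic_rows (chain_rows G xs) m"
      unfolding generic_rows_def
    proof (intro allI impI)
      fix S t
      assume S: "S \<subseteq> {..<m}" and t: "\<forall>a<card S. (\<Sum>r\<in>S. t r * chain_rows G xs r a) = 0"
      have inj: "inj_on h S" using ch S by (intro inj_onI) (metis lessThan_iff nat.inject subsetD)
      \<comment> \<open>The signs are moved into the coefficients, turning the relation into one
        between rows of \<open>g\<close>.\<close>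
      define t' where "t' X = t (inv_into S h X) * \<sigma> (set (take (Suc (inv_into S h X)) xs))" for X
      have t': "t' (h r) = t r * \<sigma> (set (take (Suc r) xs))" if "r \<in> S" for r
        using inj that by (simp add: t'_def)
      have "(\<Sum>X\<in>h ` S. t' X * g X a) = (\<Sum>r\<in>S. t r * chain_rows G xs r a)" for a
        unfolding sum.reindex[OF inj] comp_def
        by (intro sum.cong refl) (simp add: t', simp add: chain_rows_def G_def h_def)
      moreover have "card (h ` S) = card S" using inj by (rule card_image)
      moreover have "h ` S \<subseteq> R" using inR A unfolding h_def by blast
      ultimately have "\<forall>X\<in>h ` S. t' X = 0" using g(2)[of "h ` S" t'] t by metis
      then have "t r * \<sigma> (set (take (Suc r) xs)) = 0" if "r \<in> S" for r using t' that by auto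
      moreover have "\<sigma> X \<noteq> 0" for X by (simp add: \<sigma>_def)
      ultimately show "\<forall>r\<in>S. t r = 0" by simp
    qed
  qed
  moreover have "\<bar>chain_rows G xs r a - chain_rows F xs r a\<bar> \<le> e" if "xs \<in> signed_perms n" "r < n" for xs r a
  proof -
    let ?X = "set (take (Suc r) xs)"
    have "F ?X a = \<sigma> ?X * F (q ?X) a" using odd by (simp add: \<sigma>_def q_def)
    then have "\<bar>chain_rows G xs r a - chain_rows F xs r a\<bar> = \<bar>\<sigma> ?X * (g (q ?X) a - F (q ?X) a)\<bar>"
      by (simp add: chain_rows_def G_def right_diff_distrib)
    also have "\<dots> = \<bar>g (q ?X) a - F (q ?X) a\<bar>" by (simp add: \<sigma>_def abs_mult)
    also have "\<dots> \<le> e" using g(1) inR that by blast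
    finally show ?thesis .
  qed
  ultimately show ?thesis using that by blast
qed

text \<open>Take a zero of a generic approximation and scale its coefficients to sum 1; the error is
  then an average of errors at most \<open>e\<close>.\<close>

lemma odd_map_almost_zero:
  fixes F :: "(nat \<times> bool) set \<Rightarrow> nat \<Rightarrow> real"
  assumes odd: "\<And>X a. F (apsnd Not ` X) a = - F X a" and "e > 0" "n \<ge> 1"
  shows "\<exists>xs\<in>signed_perms n. \<exists>t. (\<forall>r<n. t r \<ge> 0) \<and> (\<Sum>r<n. t r) = 1 \<and>
     (\<forall>a<n-1. \<bar>\<Sum>r<n. t r * chain_rows F xs r a\<bar> \<le> e)"
proof -
  obtain G where G: "generic_odd_map G n"
    "\<And>xs r a. xs \<in> signed_perms n \<Longrightarrow> r < n \<Longrightarrow> \<bar>chain_rows G xs r a - chain_rows F xs r a\<bar> \<le> e"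
    using generic_odd_approximation[where F = F, OF odd \<open>e > 0\<close>] by blast
  interpret generic_odd_map G n by fact
  have "odd (card (zeros (n - 1)))" using odd_zeros[of "n - 1"] assms by simp
  then have "zeros (n - 1) \<noteq> {}" by auto
  then obtain xs t where xs: "xs \<in> signed_perms n" and t: "nonneg_kernel (chain_rows G xs) n (n - 1) t"
    using \<open>n \<ge> 1\<close> unfolding zeros_def by auto
  define s where "s = (\<Sum>r<n. t r)"
  have "s > 0"
  proof -
    obtain r where "r < n" "t r > 0" using t unfolding nonneg_kernel_def by blast
    then show ?thesis unfolding s_def using t
      by (intro sum_pos2[of _ r]) (auto simp: nonneg_kernel_def)
  qed
  define u where "u r = t r / s" for r
  have u0: "\<forall>r<n. u r \<ge> 0" using t \<open>s > 0\<close> by (simp add: u_def nonneg_kernel_def)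
  have u1: "(\<Sum>r<n. u r) = 1"
    using \<open>s > 0\<close> unfolding u_def sum_divide_distrib[symmetric] s_def by simp
  have "\<bar>\<Sum>r<n. u r * chain_rows F xs r a\<bar> \<le> e" if "a < n - 1" for a
  proof -
    have "(\<Sum>r<n. u r * chain_rows G xs r a) = (\<Sum>r<n. t r * chain_rows G xs r a) / s"
      by (simp add: u_def sum_divide_distrib)
    also have "\<dots> = 0" using t that by (simp add: nonneg_kernel_def)
    finally have "\<bar>\<Sum>r<n. u r * chain_rows F xs r a\<bar> = \<bar>\<Sum>r<n. u r * (chain_rows G xs r a - chain_rows F xs r a)\<bar>"
      by (simp add: right_diff_distrib sum_subtractf)
    also have "\<dots> \<le> (\<Sum>r<n. \<bar>u r * (chain_rows G xs r a - chain_rows F xs r a)\<bar>)" by (rule sum_abs)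
    also have "\<dots> \<le> (\<Sum>r<n. u r * e)"
      using u0 G(2)[OF xs] by (intro sum_mono) (simp add: abs_mult mult_left_mono)
    also have "\<dots> = e" using u1 by (simp add: sum_distrib_right[symmetric])
    finally show ?thesis .
  qed
  then show ?thesis using xs u0 u1 by blast
qed

text \<open>There are finitely many chains, so one of them carries approximate zeros of every
  precision; their coefficients are bounded and have a limit point. Normalising the sum to 1 keeps
  the limit from being zero.\<close>

theorem odd_map_zero:
  fixes F :: "(nat \<times> bool) set \<Rightarrow> nat \<Rightarrow> real"
  assumes odd: "\<And>X a. F (apsnd Not ` X) a = - F X a" and "n \<ge> 1"
  shows "\<exists>xs\<in>signed_perms n. \<exists>t. nonneg_kernel (chain_rows F xs) n (n - 1) t"
proof -
  define P where "P e xs t \<longleftrightarrow> (\<forall>r<n. t r \<ge> 0) \<and> (\<Sum>r<n. t r) = 1 \<and>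
     (\<forall>a<n-1. \<bar>\<Sum>r<n. t r * chain_rows F xs r a\<bar> \<le> e)" for e xs and t :: "nat \<Rightarrow> real"
  have ex: "\<exists>xs\<in>signed_perms n. \<exists>t. P (1 / real (Suc k)) xs t" for k
    unfolding P_def using odd_map_almost_zero[where F = F, OF odd _ \<open>n \<ge> 1\<close>] by simp
  have "\<exists>xs\<in>signed_perms n. \<forall>k. \<exists>t. P (1 / real (Suc k)) xs t"
  proof (rule ccontr)
    assume "\<not> ?thesis"
    then have "\<forall>xs\<in>signed_perms n. \<exists>k. \<forall>t. \<not> P (1 / real (Suc k)) xs t" by blast
    then obtain K where K: "\<forall>xs\<in>signed_perms n. \<forall>t. \<not> P (1 / real (Suc (K xs))) xs t"
      by metis
    \<comment> \<open>Precision \<open>m\<close> would fail on every chain at once, since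
      \<open>P\<close> weakens as its tolerance grows.\<close>
    define m where "m = Max (K ` signed_perms n)"
    obtain xs t where xs: "xs \<in> signed_perms n" "P (1 / real (Suc m)) xs t" using ex by blast
    have "K xs \<le> m" unfolding m_def using xs finite_signed_perms by simp
    then have "1 / real (Suc m) \<le> 1 / real (Suc (K xs))" by (simp add: frac_le)
    then have "P (1 / real (Suc (K xs))) xs t" using xs(2) unfolding P_def by fastforce
    with K xs show False by blast
  qed
  then obtain xs T where xs: "xs \<in> signed_perms n" and T: "\<And>k. P (1 / real (Suc k)) xs (T k)"
    by metis
  have "\<bar>T k r\<bar> \<le> 1" if "r \<in> {..<n}" for k r
  proof -
    have "T k r \<le> (\<Sum>r<n. T k r)" using T that unfolding P_def by (intro member_le_sum) auto
    then show ?thesis using T[of k] that unfolding P_def by auto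
  qed
  then obtain q l where q: "strict_mono (q :: nat \<Rightarrow> nat)" "\<forall>r\<in>{..<n}. (\<lambda>k. T (q k) r) \<longlonglongrightarrow> l r"
    using pointwise_convergent_subsequence[of "{..<n}" T 1] by auto
  have l0: "\<forall>r<n. l r \<ge> 0"
    using q T unfolding P_def by (auto intro!: LIMSEQ_le_const)
  have "(\<lambda>k. \<Sum>r<n. T (q k) r) \<longlonglongrightarrow> (\<Sum>r<n. l r)" using q by (intro tendsto_sum) auto
  moreover have "(\<lambda>k. \<Sum>r<n. T (q k) r) = (\<lambda>k. 1)" using T unfolding P_def by auto
  ultimately have "(\<Sum>r<n. l r) = 1" by (simp add: LIMSEQ_const_iff)
  then have "\<exists>r<n. l r > 0" using l0
    by (metis lessThan_iff linorder_not_less sum_nonpos zero_less_one)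
  moreover have "(\<Sum>r<n. l r * chain_rows F xs r a) = 0" if "a < n - 1" for a
  proof -
    have "(\<lambda>k. \<Sum>r<n. T (q k) r * chain_rows F xs r a) \<longlonglongrightarrow> (\<Sum>r<n. l r * chain_rows F xs r a)"
      using q by (intro tendsto_sum tendsto_mult) auto
    moreover have "(\<lambda>k. \<Sum>r<n. T (q k) r * chain_rows F xs r a) \<longlonglongrightarrow> 0"
    proof (rule Lim_null_comparison)
      show "(\<lambda>k. 1 / real (Suc (q k))) \<longlonglongrightarrow> 0"
        using LIMSEQ_subseq_LIMSEQ[OF lim_1_over_n[THEN LIMSEQ_Suc] q(1)] by (simp add: comp_def)
      show "\<forall>\<^sub>F k in sequentially. norm (\<Sum>r<n. T (q k) r * chain_rows F xs r a) \<le> 1 / real (Suc (q k))"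
        using T that unfolding P_def by (intro always_eventually) auto
    qed
    ultimately show ?thesis by (rule LIMSEQ_unique)
  qed
  ultimately show ?thesis using xs l0 unfolding nonneg_kernel_def by blast
qed

section \<open>Equicoloured Radon partitions\<close>

text \<open>Both sets are enlarged to size \<open>card Q div 2\<close>: first \<open>A'\<close>
  avoiding \<open>B'\<close>, then \<open>B'\<close> inside the complement of the new
  \<open>A\<close>.\<close>

lemma equal_card_extension:
  assumes "finite Q" "A' \<subseteq> Q" "B' \<subseteq> Q" "A' \<inter> B' = {}"
    "2 * card A' \<le> card Q" "2 * card B' \<le> card Q"
  shows "\<exists>A B. A' \<subseteq> A \<and> A \<subseteq> Q \<and> B' \<subseteq> B \<and> B \<subseteq> Q \<and> A \<inter> B = {} \<and> card A = card B"
proof -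
  have fin: "finite A'" "finite B'" using assms(1-3) by (auto intro: finite_subset)
  have "card (Q - B') = card Q - card B'" using fin assms by (intro card_Diff_subset)
  then have "card Q div 2 \<le> card (Q - B')" using assms(6) by linarith
  moreover have "card A' \<le> card Q div 2" "A' \<subseteq> Q - B'" "finite (Q - B')" using assms by auto
  ultimately obtain A where A: "A' \<subseteq> A" "A \<subseteq> Q - B'" "card A = card Q div 2"
    using exists_subset_between by metis
  have "finite A" using A assms finite_subset by blast
  have "card (Q - A) = card Q - card A" using \<open>finite A\<close> A by (intro card_Diff_subset) auto
  then have "card Q div 2 \<le> card (Q - A)" using A(3) by linarith
  moreover have "card B' \<le> card Q div 2" "B' \<subseteq> Q - A" "finite (Q - A)" using assms A by auto
  ultimately obtain B where B: "B' \<subseteq> B" "B \<subseteq> Q - A" "card B = card Q div 2"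
    using exists_subset_between by metis
  show ?thesis using A B by (intro exI[of _ A] exI[of _ B]) auto
qed

lemma equal_colours_extension:
  fixes col :: "'a \<Rightarrow> nat"
  assumes "finite P" "A' \<subseteq> P" "B' \<subseteq> P" "A' \<inter> B' = {}"
    "\<And>i. 2 * card {a \<in> A'. col a = i} \<le> card {x \<in> P. col x = i}"
    "\<And>i. 2 * card {b \<in> B'. col b = i} \<le> card {x \<in> P. col x = i}"
  shows "\<exists>A B. A' \<subseteq> A \<and> A \<subseteq> P \<and> B' \<subseteq> B \<and> B \<subseteq> P \<and> A \<inter> B = {} \<and>
     (\<forall>i. card {a \<in> A. col a = i} = card {b \<in> B. col b = i})"
proof -
  define Q where "Q i A B \<longleftrightarrow> {a \<in> A'. col a = i} \<subseteq> A \<and> A \<subseteq> {x \<in> P. col x = i} \<and>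
     {b \<in> B'. col b = i} \<subseteq> B \<and> B \<subseteq> {x \<in> P. col x = i} \<and> A \<inter> B = {} \<and> card A = card B" for i A B
  have "\<exists>A B. Q i A B" for i
    unfolding Q_def using assms by (intro equal_card_extension) auto
  then obtain A B where "\<And>i. Q i (A i) (B i)" by metis
  then have AB: "\<And>i. {a \<in> A'. col a = i} \<subseteq> A i" "\<And>i. A i \<subseteq> {x \<in> P. col x = i}"
    "\<And>i. {b \<in> B'. col b = i} \<subseteq> B i" "\<And>i. B i \<subseteq> {x \<in> P. col x = i}"
    "\<And>i. A i \<inter> B i = {}" "\<And>i. card (A i) = card (B i)"
    unfolding Q_def by blast+
  have "{a \<in> \<Union> (range A). col a = i} = A i" "{b \<in> \<Union> (range B). col b = i} = B i" for i
    using AB(2,4) by blast+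
  moreover have "\<Union> (range A) \<inter> \<Union> (range B) = {}" using AB(2,4,5) by blast
  moreover have "A' \<subseteq> \<Union> (range A)" "B' \<subseteq> \<Union> (range B)" using AB(1,3) by blast+
  moreover have "\<Union> (range A) \<subseteq> P" "\<Union> (range B) \<subseteq> P" using AB(2,4) by blast+
  ultimately show ?thesis using AB(6) by (intro exI[of _ "\<Union> (range A)"] exI[of _ "\<Union> (range B)"]) auto
qed

section \<open>Odd functions of signed sets and their zeros along a chain\<close>

definition sign_of :: "bool \<Rightarrow> real" where
  "sign_of b = (if b then 1 else - 1)"

definition signed_sum :: "(nat \<times> bool) set \<Rightarrow> (nat \<Rightarrow> real) \<Rightarrow> real" where
  "signed_sum X w = (\<Sum>z\<in>X. sign_of (snd z) * w (fst z))"

lemma signed_sum_flip: "signed_sum (apsnd Not ` X) w = - signed_sum X w"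
  unfolding signed_sum_def sum.reindex[OF inj_on_flip] sum_negf[symmetric]
  by (intro sum.cong) (auto simp: sign_of_def)

definition colour_count :: "(nat \<Rightarrow> nat) \<Rightarrow> nat \<Rightarrow> bool \<Rightarrow> (nat \<times> bool) set \<Rightarrow> nat" where
  "colour_count c j b X = card {i. (i, b) \<in> X \<and> c i = j}"

text \<open>The difference form makes this odd. On consistent sets of indices below \<open>n\<close>
  at most one term is nonzero, as both signs cannot exceed half of the colour class.\<close>

definition majority :: "nat \<Rightarrow> (nat \<Rightarrow> nat) \<Rightarrow> nat \<Rightarrow> (nat \<times> bool) set \<Rightarrow> real" where
  "majority n c j X = (let h = card {i. i < n \<and> c i = j} in
     of_bool (2 * colour_count c j True X > h) - of_bool (2 * colour_count c j False X > h))"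

lemma majority_flip: "majority n c j (apsnd Not ` X) = - majority n c j X"
proof -
  have m: "(i, b) \<in> apsnd Not ` X \<longleftrightarrow> (i, \<not> b) \<in> X" for i b
    by (metis (no_types, lifting) apsnd_conv flip_flip image_iff)
  have "colour_count c j b (apsnd Not ` X) = colour_count c j (\<not> b) X" for b
    unfolding colour_count_def m ..
  then show ?thesis by (simp add: majority_def Let_def)
qed

text \<open>Take for \<open>Y\<close> the largest chain member with positive coefficient. If one
  sign had a majority in \<open>Y\<close>, the other would have none in any member contained in
  \<open>Y\<close>; all majority terms would then have the same sign, with a nonzero one at
  \<open>Y\<close>.\<close>

lemma chain_solution:
  assumes xs: "xs \<in> signed_perms n" and t: "nonneg_kernel M n q t"
  obtains Y \<omega> where "Y \<noteq> {}" "Y \<subseteq> set xs" "\<forall>z\<in>Y. \<omega> z > 0"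
    "\<And>w. (\<Sum>r<n. t r * signed_sum (set (take (Suc r) xs)) w) = (\<Sum>z\<in>Y. \<omega> z * (sign_of (snd z) * w (fst z)))"
    "\<And>c j. (\<Sum>r<n. t r * majority n c j (set (take (Suc r) xs))) = 0 \<Longrightarrow>
       \<forall>b. 2 * colour_count c j b Y \<le> card {i. i < n \<and> c i = j}"
proof -
  define X where "X r = set (take (Suc r) xs)" for r
  define R where "R = Max {r. r < n \<and> t r > 0}"
  have "R \<in> {r. r < n \<and> t r > 0}"
    unfolding R_def using t by (intro Max_in) (auto simp: nonneg_kernel_def)
  then have R: "R < n" "t R > 0" by auto
  have Rmax: "r \<le> R" if "r < n" "t r > 0" for r
    unfolding R_def using that by (intro Max_ge) auto
  have l: "length xs = n" using xs length_signed_perms by blast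
  have t0: "t r \<ge> 0" if "r < n" for r using t that by (simp add: nonneg_kernel_def)
  have sub: "X r \<subseteq> X R" if "r < n" "t r > 0" for r
    unfolding X_def using Rmax[OF that] by (intro set_take_subset_set_take) simp
  \<comment> \<open>Exchanging summations, an element collects the coefficients of all members
    containing it; on \<open>X R\<close> this includes \<open>t R > 0\<close>.\<close>
  define \<omega> where "\<omega> z = (\<Sum>r<n. if z \<in> X r then t r else 0)" for z
  have YN: "X R \<noteq> {}" unfolding X_def using l R by auto
  have Ysub: "X R \<subseteq> set xs" unfolding X_def by (rule set_take_subset)
  have pos: "\<forall>z\<in>X R. \<omega> z > 0"
  proof
    fix z assume "z \<in> X R"
    then show "\<omega> z > 0" unfolding \<omega>_def using R t0 by (intro sum_pos2[of _ R]) auto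
  qed
  have sums: "(\<Sum>r<n. t r * signed_sum (X r) w) = (\<Sum>z\<in>X R. \<omega> z * (sign_of (snd z) * w (fst z)))" for w
  proof -
    have "t r * signed_sum (X r) w = (\<Sum>z\<in>X R. (if z \<in> X r then t r else 0) * (sign_of (snd z) * w (fst z)))"
      if "r < n" for r
    proof (cases "t r = 0")
      case True
      then show ?thesis by (simp cong: if_cong)
    next
      case False
      then have "X r \<subseteq> X R" using sub t0 that by (metis order_le_less)
      then have "(\<Sum>z\<in>X R. (if z \<in> X r then t r else 0) * (sign_of (snd z) * w (fst z))) =
          (\<Sum>z\<in>X r. (if z \<in> X r then t r else 0) * (sign_of (snd z) * w (fst z)))"
        by (intro sum.mono_neutral_right) (auto simp: X_def)
      also have "\<dots> = (\<Sum>z\<in>X r. t r * (sign_of (snd z) * w (fst z)))"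
        by (intro sum.cong) auto
      finally show ?thesis by (simp add: signed_sum_def sum_distrib_left)
    qed
    then have "(\<Sum>r<n. t r * signed_sum (X r) w) =
        (\<Sum>r<n. \<Sum>z\<in>X R. (if z \<in> X r then t r else 0) * (sign_of (snd z) * w (fst z)))"
      by (intro sum.cong) auto
    also have "\<dots> = (\<Sum>z\<in>X R. \<Sum>r<n. (if z \<in> X r then t r else 0) * (sign_of (snd z) * w (fst z)))"
      by (rule sum.swap)
    finally show ?thesis unfolding \<omega>_def sum_distrib_right .
  qed
  have maj: "2 * colour_count c j b (X R) \<le> card {i. i < n \<and> c i = j}"
    if zero: "(\<Sum>r<n. t r * majority n c j (X r)) = 0" for c j b
  proof (rule ccontr)
    define h where "h = card {i. i < n \<and> c i = j}"
    assume "\<not> ?thesis"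
    then have big: "2 * colour_count c j b (X R) > h" by (simp add: h_def)
    have memn: "i < n" if "(i, b') \<in> X R" for i b'
    proof -
      have "i \<in> fst ` set xs" using that Ysub by force
      then show ?thesis using xs by (auto simp: signed_perms_def)
    qed
    have fin: "finite {i. (i, b') \<in> X R \<and> c i = j}" for b'
    proof (rule finite_subset)
      show "{i. (i, b') \<in> X R \<and> c i = j} \<subseteq> {..<n}" using memn by blast
    qed simp
    have "colour_count c j b (X R) + colour_count c j (\<not> b) (X R) =
        card ({i. (i, b) \<in> X R \<and> c i = j} \<union> {i. (i, \<not> b) \<in> X R \<and> c i = j})"
      unfolding colour_count_def
    proof (rule card_Un_disjoint[symmetric])
      show "{i. (i, b) \<in> X R \<and> c i = j} \<inter> {i. (i, \<not> b) \<in> X R \<and> c i = j} = {}"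
        using signed_perms_mem_iff[OF xs] memn Ysub by (cases b) auto
    qed (use fin in auto)
    also have "\<dots> \<le> h" unfolding h_def
    proof (rule card_mono)
      show "{i. (i, b) \<in> X R \<and> c i = j} \<union> {i. (i, \<not> b) \<in> X R \<and> c i = j} \<subseteq> {i. i < n \<and> c i = j}"
        using memn by auto
    qed simp
    finally have small: "2 * colour_count c j (\<not> b) (X R) \<le> h" using big by linarith
    \<comment> \<open>Members with nonzero coefficient lie in \<open>X R\<close>, so the minority
      sign contributes nothing to their majority term.\<close>
    have summand: "t r * (sign_of b * majority n c j (X r)) = t r * of_bool (2 * colour_count c j b (X r) > h)"
      if "r < n" for r
    proof (cases "t r = 0")
      case False
      then have "X r \<subseteq> X R" using sub t0 that by (metis order_le_less)
      then have "colour_count c j (\<not> b) (X r) \<le> colour_count c j (\<not> b) (X R)"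
        unfolding colour_count_def by (intro card_mono fin) blast
      then have "\<not> 2 * colour_count c j (\<not> b) (X r) > h" using small by linarith
      then show ?thesis by (cases b) (simp_all add: majority_def Let_def h_def sign_of_def)
    qed simp
    have "0 = sign_of b * (\<Sum>r<n. t r * majority n c j (X r))" using zero by simp
    also have "\<dots> = (\<Sum>r<n. t r * (sign_of b * majority n c j (X r)))"
      by (simp add: sum_distrib_left mult.left_commute)
    also have "\<dots> = (\<Sum>r<n. t r * of_bool (2 * colour_count c j b (X r) > h))"
      using summand by (intro sum.cong) auto
    also have "\<dots> > 0" using R big t0 by (intro sum_pos2[of _ R]) auto
    finally show False by simp
  qed
  show ?thesis
    by (rule that[of "X R" \<omega>]) (use YN Ysub pos sums maj in \<open>auto simp: X_def\<close>)
qed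

theorem theorem3:
  fixes P :: "(real ^ 'd) set" and col :: "real ^ 'd \<Rightarrow> nat" and k :: nat
  assumes "k \<ge> 1"
    and "finite P"
    and "card P = k + CARD('d) + 2"
    and "col ` P \<subseteq> {..<k}"
  shows "\<exists>A B. A \<subseteq> P \<and> B \<subseteq> P \<and> A \<inter> B = {} \<and>
           (\<forall>i. card {a\<in>A. col a = i} = card {b\<in>B. col b = i}) \<and>
           convex hull A \<inter> convex hull B \<noteq> {}"
proof -
  define d where "d = CARD('d)"
  define n where "n = k + d + 2"
  obtain p where p: "bij_betw p {..<n} P"
    using ex_bij_betw_nat_finite[OF \<open>finite P\<close>] assms(3) by (auto simp: n_def d_def atLeast0LessThan)
  obtain e where e: "bij_betw e {..<d} (UNIV :: 'd set)"
    using ex_bij_betw_nat_finite[of "UNIV :: 'd set"] by (auto simp: d_def atLeast0LessThan)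
  have pinj: "inj_on p {..<n}" and pim: "p ` {..<n} = P" using p by (auto simp: bij_betw_def)
  define c where "c i = col (p i)" for i
  \<comment> \<open>Positions \<open>d + 1 + j\<close> hold the majority of colour \<open>j\<close>,
    so the constraints are the first \<open>d + 1 + k = n - 1\<close> coordinates, the number
    handled by \<open>odd_map_zero\<close>.\<close>
  define F where "F X a = (if a < d then signed_sum X (\<lambda>i. p i $ e a)
     else if a = d then signed_sum X (\<lambda>_. 1) else majority n c (a - d - 1) X)" for X a
  have "F (apsnd Not ` X) a = - F X a" for X a
    by (simp add: F_def signed_sum_flip majority_flip)
  then obtain xs t where xs: "xs \<in> signed_perms n" and t: "nonneg_kernel (chain_rows F xs) n (n - 1) t"
    using odd_map_zero[of F n] by (auto simp: n_def)
  obtain Y \<omega> where Y: "Y \<noteq> {}" "Y \<subseteq> set xs" "\<forall>z\<in>Y. \<omega> z > 0"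
    and sums: "\<And>w. (\<Sum>r<n. t r * signed_sum (set (take (Suc r) xs)) w) =
        (\<Sum>z\<in>Y. \<omega> z * (sign_of (snd z) * w (fst z)))"
    and maj: "\<And>c j. (\<Sum>r<n. t r * majority n c j (set (take (Suc r) xs))) = 0 \<Longrightarrow>
       \<forall>b. 2 * colour_count c j b Y \<le> card {i. i < n \<and> c i = j}"
    by (rule chain_solution[OF xs t]) (rule that)
  have zero: "(\<Sum>r<n. t r * F (set (take (Suc r) xs)) a) = 0" if "a < k + d + 1" for a
    using t that unfolding nonneg_kernel_def chain_rows_def n_def by simp
  define I where "I b = {i. (i, b) \<in> Y}" for b
  have In: "I b \<subseteq> {..<n}" for b
  proof
    fix i assume "i \<in> I b"
    then have "i \<in> fst ` set xs" using Y(2) by (force simp: I_def)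
    then show "i \<in> {..<n}" using xs by (auto simp: signed_perms_def)
  qed
  have finI: "finite (I b)" for b using In finite_subset by blast
  have disj: "I True \<inter> I False = {}"
  proof -
    have False if "(i, True) \<in> Y" "(i, False) \<in> Y" for i
    proof -
      have "i < n" using that In by (auto simp: I_def)
      then show False using signed_perms_mem_iff[OF xs] that Y(2) by blast
    qed
    then show ?thesis by (auto simp: I_def)
  qed
  have Yeq: "Y = (\<lambda>i. (i, True)) ` I True \<union> (\<lambda>i. (i, False)) ` I False"
  proof (intro equalityI subsetI)
    fix z assume "z \<in> Y"
    then show "z \<in> (\<lambda>i. (i, True)) ` I True \<union> (\<lambda>i. (i, False)) ` I False"
      by (cases z; cases "snd z") (auto simp: I_def)
  qed (auto simp: I_def)
  define \<alpha> where "\<alpha> b i = \<omega> (i, b)" for b i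
  have \<alpha>pos: "\<alpha> b i > 0" if "i \<in> I b" for b i using that Y(3) by (simp add: \<alpha>_def I_def)
  have split: "(\<Sum>z\<in>Y. \<omega> z * (sign_of (snd z) * w (fst z))) =
      (\<Sum>i\<in>I True. \<alpha> True i * w i) - (\<Sum>i\<in>I False. \<alpha> False i * w i)" for w
  proof -
    have "(\<Sum>z\<in>Y. \<omega> z * (sign_of (snd z) * w (fst z))) =
       (\<Sum>z\<in>(\<lambda>i. (i, True)) ` I True. \<omega> z * (sign_of (snd z) * w (fst z))) +
       (\<Sum>z\<in>(\<lambda>i. (i, False)) ` I False. \<omega> z * (sign_of (snd z) * w (fst z)))"
      unfolding Yeq using finI by (intro sum.union_disjoint) auto
    then show ?thesis
      by (simp add: sum.reindex inj_on_def \<alpha>_def sign_of_def sum_negf)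
  qed
  \<comment> \<open>Coordinate \<open>d\<close> gives both sign classes the same total weight, so
    one normaliser makes both barycentres convex combinations.\<close>
  define W where "W = (\<Sum>i\<in>I True. \<alpha> True i)"
  have eq1: "(\<Sum>i\<in>I False. \<alpha> False i) = W"
    using zero[of d] sums[of "\<lambda>_. 1"] split[of "\<lambda>_. 1"] by (simp add: F_def W_def)
  have Wpos: "W > 0"
  proof (cases "I True = {}")
    case True
    then have "I False \<noteq> {}" using Y(1) Yeq by auto
    then show ?thesis unfolding eq1[symmetric] using finI \<alpha>pos by (intro sum_pos) auto
  next
    case False
    then show ?thesis unfolding W_def using finI \<alpha>pos by (intro sum_pos) auto
  qed
  define y where "y b = (\<Sum>i\<in>I b. (\<alpha> b i / W) *\<^sub>R p i)" for b
  \<comment> \<open>The first \<open>d\<close> coordinates of \<open>F\<close> equate the two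
    weighted sums of points.\<close>
  have "y True = y False"
  proof (rule vec_eq_iff[THEN iffD2], rule allI)
    fix s :: 'd
    obtain a where a: "a < d" "s = e a" using e by (metis UNIV_I bij_betw_def imageE lessThan_iff)
    have "(\<Sum>i\<in>I True. \<alpha> True i * p i $ s) = (\<Sum>i\<in>I False. \<alpha> False i * p i $ s)"
      using zero[of a] sums[of "\<lambda>i. p i $ s"] split[of "\<lambda>i. p i $ s"] a by (simp add: F_def)
    then show "y True $ s = y False $ s"
      by (simp add: y_def sum_divide_distrib[symmetric])
  qed
  moreover have "y b \<in> convex hull (p ` I b)" for b
    unfolding y_def
  proof (rule convex_sum)
    have "(\<Sum>i\<in>I b. \<alpha> b i) = W" using eq1 W_def by (cases b) auto
    then show "(\<Sum>i\<in>I b. \<alpha> b i / W) = 1" using Wpos by (simp add: sum_divide_distrib[symmetric])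
    show "0 \<le> \<alpha> b i / W" if "i \<in> I b" for i using \<alpha>pos[OF that] Wpos by simp
    show "p i \<in> convex hull (p ` I b)" if "i \<in> I b" for i using that by (simp add: hull_inc)
  qed (use finI in auto)
  ultimately have hull: "y True \<in> convex hull (p ` I True) \<inter> convex hull (p ` I False)"
    by (metis IntI)
  \<comment> \<open>For \<open>j < k\<close> this is the vanishing majority coordinate of colour
    \<open>j\<close>; larger colours do not occur in \<open>P\<close>.\<close>
  have count: "2 * card {a \<in> p ` I b. col a = j} \<le> card {x \<in> P. col x = j}" for b j
  proof (cases "j < k")
    case True
    have "{a \<in> p ` I b. col a = j} = p ` {i. (i, b) \<in> Y \<and> c i = j}"
      by (auto simp: I_def c_def)
    moreover have "inj_on p {i. (i, b) \<in> Y \<and> c i = j}"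
      using pinj In[of b] by (intro inj_on_subset[OF pinj]) (auto simp: I_def)
    ultimately have "card {a \<in> p ` I b. col a = j} = colour_count c j b Y"
      by (simp add: card_image colour_count_def)
    moreover have "{x \<in> P. col x = j} = p ` {i. i < n \<and> c i = j}"
      using pim by (auto simp: c_def)
    then have "card {x \<in> P. col x = j} = card {i. i < n \<and> c i = j}"
      using inj_on_subset[OF pinj, of "{i. i < n \<and> c i = j}"] by (simp add: card_image subset_iff)
    moreover have "(\<Sum>r<n. t r * majority n c j (set (take (Suc r) xs))) = 0"
      using zero[of "d + 1 + j"] True by (simp add: F_def)
    ultimately show ?thesis using maj[of c j] by simp
  next
    case False
    have "p ` I b \<subseteq> P" using In pim by blast
    then have "{a \<in> p ` I b. col a = j} = {}" using False assms(4) by auto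
    then show ?thesis by (simp only: card.empty)
  qed
  have sub: "p ` I b \<subseteq> P" for b using In pim by blast
  have "p ` I True \<inter> p ` I False = {}"
    using disj inj_on_image_Int[OF pinj In In, of True False] by simp
  \<comment> \<open>Points with coefficient zero now equalise the colours; enlarging both sets keeps
    the common hull point.\<close>
  from equal_colours_extension[OF \<open>finite P\<close> sub sub this count count]
  obtain A B where AB: "p ` I True \<subseteq> A" "A \<subseteq> P" "p ` I False \<subseteq> B" "B \<subseteq> P" "A \<inter> B = {}"
    "\<forall>i. card {a \<in> A. col a = i} = card {b \<in> B. col b = i}" by blast
  have "y True \<in> convex hull A \<inter> convex hull B"
    using hull hull_mono[OF AB(1)] hull_mono[OF AB(3)] by blast
  then show ?thesis using AB by blast
qed

end
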